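(* In the Main Setting described in the context, let $U\subset X$ be open, and let $q_i:=|F_{\nabla_i}|^2-|\nabla_i\Phi_i|^2$ and $q_i^+:=\max\{0,q_i\}$. Suppose there exist $\Lambda_U<\infty$ and $i_U\in\mathbb N$ such that, for every $i\ge i_U$ and every geodesic ball $B_s(y)\subset U$ with $0<s\le r_0$, $$m_i^{-1}s^{2-n}\int_{B_s(y)}q_i^+\le\Lambda_U .$$ Then effective codimension-three monotonicity holds on $U$, with $\gamma_U=1$. The same conclusion holds under the stronger curvature Morrey bound $$m_i^{-1}s^{2-n}\int_{B_s(y)}|F_{\nabla_i}|^2\le\Lambda_U$$ for every $i\geq i_U$ and every such ball.
   Context: Geometry. $(X^n,g,\Theta)$ is one of: (a) $n=7$, a complete connected noncompact one-ended asymptotically conical (AC) manifold with torsion-free $\mathrm G_2$-structure $\varphi$, and $\Theta=\psi=*\varphi$; (b) $n=6$, a complete connected noncompact one-ended AC Calabi--Yau $3$-fold with torsion-free $\mathrm{SU}(3)$-structure $(\omega,\Omega)$, and $\Theta=\operatorname{Re}\Omega$. AC means: outside a compact set $X$ is diffeomorphic to $(1,\infty)_r\times\Sigma$ with $\Sigma$ a closed oriented $(n-1)$-manifold (the link), and for some $\nu_0<0$, $|D_C^j(g-g_C)|_{g_C}=O(r^{\nu_0-j})$ for all $j\ge0$, where $g_C=dr^2+r^2g_\Sigma$ with Levi-Civita connection $D_C$; the special holonomy forms are likewise asymptotic to the homogeneous conical ones. $\rho:X\to[1,\infty)$ is a smooth function extending $r$, and $\Theta_\infty\in H^{n-3}(\Sigma;\mathbb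 R)$ is the class of $\Theta|_{\{\rho=R\}}$, $R\gg1$. Gauge theory. $G\in\{\mathrm{SU}(2),\mathrm{SO}(3)\}$; $P\to X$ is a fixed principal $G$-bundle with adjoint bundle $\mathfrak g_P$; norms use $\langle a,b\rangle=-2\operatorname{tr}(ab)$ on $\mathfrak{su}(2)$, resp. $\langle A,B\rangle=-\frac12\operatorname{tr}_{\mathbb R^3}(AB)$ on $\mathfrak{so}(3)$. A $\Theta$-monopole is a smooth pair $(\nabla,\Phi)$, $\nabla$ a connection on $P$ with curvature $F_\nabla$ and $\Phi\in\Gamma(\mathfrak g_P)$, with $F_\nabla\wedge\Theta=*\nabla\Phi$ and, in case (b), also $F_\nabla\wedge\omega^2=0$. It is irreducible if $\nabla\Phi\not\equiv0$; its intermediate energy is $\mathcal E^\Theta(\nabla,\Phi)=\frac12\int_X(|F_\nabla\wedge\Theta|^2+|\nabla\Phi|^2)$. Main Setting. $(\nabla_i,\Phi_i)$ is a sequence of irreducible $\Theta$-monopoles on $P$ with $\mathcal E^\Theta(\nabla_i,\Phi_i)<\infty$ and $|F_{\nabla_i}|=O_i(\rho^{-2})$ as $\rho\to\infty$ (constant may depend on $i$). It is known that then the mass $m_i=\lim_{\rho\to\infty}|\Phi_i|\in(0,\infty)$ exists and, up to gauge, $(\nabla_i,\Phi_i)|_{\{\rho=R\}}$ converges uniformly as $R\to\infty$ to a pair $(\nabla_{\infty,i},\Phi_{\infty,i})$ on a $G$-bundle over $\Sigma$ with $\nabla_{\infty,i}\Phi_{\infty,i}=0$, $|\Phi_{\infty,i}|=m_i$.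 The monopole class is $\beta_i=\frac12e(\langle\Phi_{\infty,i}\rangle^\perp)\in H^2(\Sigma;\mathbb R)$, where the rank-two orthogonal complement in the adjoint bundle is oriented by the stabilizer circle of $\Phi_{\infty,i}$, with the sign convention for which $\mathcal E^\Theta(\nabla_i,\Phi_i)=4\pi m_i\langle\beta_i\cup\Theta_\infty,[\Sigma]\rangle$. Assume $m_i\to+\infty$, $\beta_i=\beta$ is independent of $i$, and $k:=\langle\beta\cup\Theta_\infty,[\Sigma]\rangle\neq0$ (so $k>0$). Notation. $e_i:=|F_{\nabla_i}|^2+|\nabla_i\Phi_i|^2$, $\theta_i(x,r):=m_i^{-1}r^{3-n}\int_{B_r(x)}e_i$. $c\ge0$, $r_0>0$ are constants depending only on the background geometry, fixed so that the stress-energy inequality $$\frac{d}{dr}\bigl(e^{cr^2}\theta_i(x,r)\bigr)\ge2m_i^{-1}e^{cr^2}r^{3-n}\int_{\partial B_r(x)}\bigl(|\partial_{r_x}\lrcorner F_{\nabla_i}|^2+|\nabla_{\partial_{r_x}}\Phi_i|^2\bigr)-e^{cr^2}r^{2-n}m_i^{-1}\int_{B_r(x)}q_i$$ holds for all $i$, $x\in X$, $0<r\le r_0$, where $\partial_{r_x}$ is the outward unit normal of $\partial B_r(x)$. Effective codimension-three monotonicity holds on an open set $U$ if there exist $A_U\in(0,\infty)$, $i_U\in\mathbb N$, $\gamma_U\in(0,\infty)$ such that for every $i\ge i_U$, every geodesic ball $B_r(x)\subset U$, and every $0<s<r\le r_0$: $e^{cs^2}\theta_i(x,s)\le e^{cr^2}\theta_i(x,r)+A_Ur^{\gamma_U}$.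 *)

theory Defs
  imports "HOL-Analysis.Analysis"
begin

text \<open>
  The library has no manifolds, bundles or connections, so this theory sets them up in classical
  coordinate form: tensor fields are families of components indexed by charts, subject to the usual
  transformation laws, and principal bundles are given by local gauges (local sections) and their
  transition functions.  Whenever a pointwise invariant quantity is needed, it is computed in an
  arbitrarily chosen chart, gauge or orthonormal frame; by the transformation laws the choice does
  not matter.
\<close>

section \<open>Smooth manifolds\<close>

primrec iter_deriv ::
  "('a::euclidean_space \<Rightarrow> 'b::real_normed_vector) \<Rightarrow> 'a list \<Rightarrow> 'a \<Rightarrow> 'b" where
  "iter_deriv f [] = f"
| "iter_deriv f (v # vs) = (\<lambda>x. frechet_derivative (iter_deriv f vs) (at x) v)"

definition smooth_map :: "'a::euclidean_space set \<Rightarrow> ('a \<Rightarrow> 'b::real_normed_vector) \<Rightarrow> bool" where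
  "smooth_map S f \<longleftrightarrow> open S \<and> (\<forall>vs. \<forall>x\<in>S. iter_deriv f vs differentiable (at x))"

type_synonym ('x, 'e) chart = "'x set \<times> ('x \<Rightarrow> 'e)"

text \<open>Covariant tensor fields with values in \<open>'v\<close>: \<open>T \<kappa> x [v\<^sub>1, \<dots>, v\<^sub>k]\<close> is the value at the
  point \<open>x\<close> on the tangent vectors whose components in the chart \<open>\<kappa>\<close> are the \<open>v\<^sub>j\<close>.  Only lists
  of length equal to the rank matter.\<close>

type_synonym ('x, 'e, 'v) tfield = "('x, 'e) chart \<Rightarrow> 'x \<Rightarrow> 'e list \<Rightarrow> 'v"

record ('x, 'e) riem =
  atlas :: "('x, 'e) chart set"
  met :: "('x, 'e, real) tfield"
  volf :: "('x, 'e, real) tfield"  \<comment> \<open>the Riemannian volume form; it encodes the orientation\<close>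

definition carr :: "('x, 'e) riem \<Rightarrow> 'x set" where
  "carr M = (\<Union>\<kappa>\<in>atlas M. fst \<kappa>)"

definition cinv :: "('x, 'e) chart \<Rightarrow> 'e \<Rightarrow> 'x" where
  "cinv \<kappa> = inv_into (fst \<kappa>) (snd \<kappa>)"

definition smooth_atlas ::
  "('x::topological_space, 'e::euclidean_space) chart set \<Rightarrow> bool" where
  "smooth_atlas A \<longleftrightarrow>
     (\<forall>\<kappa>\<in>A. open (fst \<kappa>) \<and> open (snd \<kappa> ` fst \<kappa>) \<and>
        homeomorphism (fst \<kappa>) (snd \<kappa> ` fst \<kappa>) (snd \<kappa>) (cinv \<kappa>)) \<and>
     (\<forall>\<kappa>\<in>A. \<forall>\<mu>\<in>A. smooth_map (snd \<kappa> ` (fst \<kappa> \<inter> fst \<mu>)) (snd \<mu> \<circ> cinv \<kappa>))"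

definition chart_at :: "('x, 'e) riem \<Rightarrow> 'x \<Rightarrow> ('x, 'e) chart" where
  "chart_at M x = (SOME \<kappa>. \<kappa> \<in> atlas M \<and> x \<in> fst \<kappa>)"

definition pd :: "('x, 'e::euclidean_space) chart \<Rightarrow> ('x \<Rightarrow> 'v::real_normed_vector) \<Rightarrow> 'x \<Rightarrow> 'e \<Rightarrow> 'v"
  where "pd \<kappa> u x v = frechet_derivative (\<lambda>p. u (cinv \<kappa> p)) (at (snd \<kappa> x)) v"

definition smooth_fun ::
  "('x, 'e::euclidean_space) riem \<Rightarrow> 'x set \<Rightarrow> ('x \<Rightarrow> 'v::real_normed_vector) \<Rightarrow> bool" where
  "smooth_fun M D u \<longleftrightarrow> (\<forall>\<kappa>\<in>atlas M. smooth_map (snd \<kappa> ` (fst \<kappa> \<inter> D)) (u \<circ> cinv \<kappa>))"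

definition smooth_mfd_map ::
  "('x::topological_space, 'e::euclidean_space) riem \<Rightarrow> ('y::topological_space, 'f::euclidean_space) riem
     \<Rightarrow> 'x set \<Rightarrow> ('x \<Rightarrow> 'y) \<Rightarrow> bool" where
  "smooth_mfd_map M N D h \<longleftrightarrow> continuous_on D h \<and>
     (\<forall>\<kappa>\<in>atlas M. \<forall>\<mu>\<in>atlas N.
        smooth_map (snd \<kappa> ` (fst \<kappa> \<inter> D \<inter> h -` fst \<mu>)) (\<lambda>p. snd \<mu> (h (cinv \<kappa> p))))"

section \<open>Tensor fields and differential forms\<close>

definition tensor_on ::
  "('x, 'e::euclidean_space) riem \<Rightarrow> 'x set \<Rightarrow> nat \<Rightarrow> ('x, 'e, 'v::real_normed_vector) tfield \<Rightarrow> bool"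
  where
  "tensor_on M D k T \<longleftrightarrow>
     (\<forall>\<kappa>\<in>atlas M. \<forall>x\<in>fst \<kappa> \<inter> D. \<forall>vs. length vs = k \<longrightarrow> (\<forall>j<k. linear (\<lambda>v. T \<kappa> x (vs[j := v])))) \<and>
     (\<forall>\<kappa>\<in>atlas M. \<forall>vs. length vs = k \<longrightarrow>
        smooth_map (snd \<kappa> ` (fst \<kappa> \<inter> D)) (\<lambda>p. T \<kappa> (cinv \<kappa> p) vs)) \<and>
     (\<forall>\<kappa>\<in>atlas M. \<forall>\<mu>\<in>atlas M. \<forall>x\<in>fst \<kappa> \<inter> fst \<mu> \<inter> D. \<forall>vs. length vs = k \<longrightarrow>
        T \<kappa> x vs = T \<mu> x (map (pd \<kappa> (snd \<mu>) x) vs))"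

definition form_on ::
  "('x, 'e::euclidean_space) riem \<Rightarrow> nat \<Rightarrow> ('x, 'e, 'v::real_normed_vector) tfield \<Rightarrow> bool" where
  "form_on M k T \<longleftrightarrow> tensor_on M (carr M) k T \<and>
     (\<forall>\<kappa>\<in>atlas M. \<forall>x\<in>fst \<kappa>. \<forall>vs. length vs = k \<longrightarrow>
        (\<forall>i<k. \<forall>j<k. i \<noteq> j \<and> vs ! i = vs ! j \<longrightarrow> T \<kappa> x vs = 0))"

definition pullback ::
  "('y, 'f::euclidean_space) riem \<Rightarrow> ('x \<Rightarrow> 'y) \<Rightarrow> ('y, 'f, 'v) tfield \<Rightarrow> ('x, 'e::euclidean_space, 'v) tfield"
  where
  "pullback N h T \<kappa> x vs =
     (let \<mu> = chart_at N (h x) in T \<mu> (h x) (map (pd \<kappa> (\<lambda>y. snd \<mu> (h y)) x) vs))"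

text \<open>Wedge product of a (possibly vector-valued) \<open>p\<close>-form with a real \<open>q\<close>-form, normalised so
  that \<open>(e\<^sup>1 \<and> e\<^sup>2)(e\<^sub>1, e\<^sub>2) = 1\<close>.\<close>

definition wedge ::
  "nat \<Rightarrow> nat \<Rightarrow> ('e list \<Rightarrow> 'v::real_vector) \<Rightarrow> ('e list \<Rightarrow> real) \<Rightarrow> 'e list \<Rightarrow> 'v" where
  "wedge p q a b vs = (1 / (fact p * fact q)) *\<^sub>R
     (\<Sum>\<sigma> | \<sigma> permutes {..<p + q}.
        (let ws = map (\<lambda>i. vs ! \<sigma> i) [0..<p + q]
         in (of_int (sign \<sigma>) * b (drop p ws)) *\<^sub>R a (take p ws)))"

definition ext_d ::
  "('x, 'e::euclidean_space, 'v::real_normed_vector) tfield \<Rightarrow> ('x, 'e, 'v) tfield" where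
  "ext_d T \<kappa> x vs = (\<Sum>j<length vs.
     (-1) ^ j *\<^sub>R pd \<kappa> (\<lambda>y. T \<kappa> y (take j vs @ drop (Suc j) vs)) x (vs ! j))"

definition closed_form ::
  "('x, 'e::euclidean_space) riem \<Rightarrow> nat \<Rightarrow> ('x, 'e, real) tfield \<Rightarrow> bool" where
  "closed_form M k a \<longleftrightarrow> form_on M k a \<and>
     (\<forall>\<kappa>\<in>atlas M. \<forall>x\<in>fst \<kappa>. \<forall>vs. length vs = Suc k \<longrightarrow> ext_d a \<kappa> x vs = 0)"

text \<open>Equality of the classes of two \<open>k\<close>-forms in \<open>H\<^sup>k(M; \<real>)\<close> (de Rham), for \<open>k \<ge> 1\<close>.\<close>

definition cohomologous ::
  "('x, 'e::euclidean_space) riem \<Rightarrow> nat \<Rightarrow> ('x, 'e, real) tfield \<Rightarrow> ('x, 'e, real) tfield \<Rightarrow> bool" where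
  "cohomologous M k a b \<longleftrightarrow> closed_form M k a \<and> closed_form M k b \<and>
     (\<exists>\<eta>. form_on M (k - 1) \<eta> \<and>
        (\<forall>\<kappa>\<in>atlas M. \<forall>x\<in>fst \<kappa>. \<forall>vs. length vs = k \<longrightarrow>
           a \<kappa> x vs - b \<kappa> x vs = ext_d \<eta> \<kappa> x vs))"

section \<open>Riemannian geometry\<close>

definition orthobasis :: "('e::euclidean_space list \<Rightarrow> real) \<Rightarrow> 'e set \<Rightarrow> bool" where
  "orthobasis G E \<longleftrightarrow> finite E \<and> card E = DIM('e) \<and>
     (\<forall>u\<in>E. \<forall>v\<in>E. G [u, v] = (if u = v then 1 else 0))"

definition oriented_riem ::
  "('x::topological_space, 'e::euclidean_space) riem \<Rightarrow> bool" where
  "oriented_riem M \<longleftrightarrow> smooth_atlas (atlas M) \<and>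
     tensor_on M (carr M) 2 (met M) \<and>
     (\<forall>\<kappa>\<in>atlas M. \<forall>x\<in>fst \<kappa>.
        (\<forall>v w. met M \<kappa> x [v, w] = met M \<kappa> x [w, v]) \<and>
        (\<forall>v. v \<noteq> 0 \<longrightarrow> met M \<kappa> x [v, v] > 0)) \<and>
     form_on M DIM('e) (volf M) \<and>
     (\<forall>\<kappa>\<in>atlas M. \<forall>x\<in>fst \<kappa>. \<forall>vs. orthobasis (met M \<kappa> x) (set vs) \<and> length vs = DIM('e) \<longrightarrow>
        \<bar>volf M \<kappa> x vs\<bar> = 1)"

definition frame :: "('e::euclidean_space list \<Rightarrow> real) \<Rightarrow> 'e set" where
  "frame G = (SOME E. orthobasis G E)"

text \<open>Squared norm of a rank \<open>k\<close> tensor with values in a space with inner product \<open>ip\<close>; on forms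
  the norm divides out \<open>k!\<close>, so that \<open>|e\<^sup>1 \<and> \<dots> \<and> e\<^sup>k| = 1\<close>.\<close>

definition tensor_norm2 ::
  "('e::euclidean_space list \<Rightarrow> real) \<Rightarrow> ('v \<Rightarrow> 'v \<Rightarrow> real) \<Rightarrow> nat \<Rightarrow> ('e list \<Rightarrow> 'v) \<Rightarrow> real" where
  "tensor_norm2 G ip k t = (\<Sum>vs | length vs = k \<and> set vs \<subseteq> frame G. ip (t vs) (t vs))"

definition form_norm2 ::
  "('e::euclidean_space list \<Rightarrow> real) \<Rightarrow> ('v \<Rightarrow> 'v \<Rightarrow> real) \<Rightarrow> nat \<Rightarrow> ('e list \<Rightarrow> 'v) \<Rightarrow> real" where
  "form_norm2 G ip k t = tensor_norm2 G ip k t / fact k"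

text \<open>Hodge star of a \<open>p\<close>-form at a point with metric \<open>G\<close> and volume form \<open>\<mu>\<close>, i.e. the
  contraction \<open>(*t)(w) = 1/p! \<Sum> \<mu>(e\<^sub>I, w) t(e\<^sub>I)\<close> over an orthonormal frame; this is the
  convention \<open>s \<and> *t = \<langle>s, t\<rangle> \<mu>\<close>.\<close>

definition hodge ::
  "('e::euclidean_space list \<Rightarrow> real) \<Rightarrow> ('e list \<Rightarrow> real) \<Rightarrow> nat \<Rightarrow> ('e list \<Rightarrow> 'v::real_vector)
     \<Rightarrow> 'e list \<Rightarrow> 'v" where
  "hodge G \<mu> p t ws = (1 / fact p) *\<^sub>R
     (\<Sum>vs | length vs = p \<and> set vs \<subseteq> frame G. \<mu> (vs @ ws) *\<^sub>R t vs)"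

text \<open>Levi-Civita connection, through the Koszul formula for coordinate vector fields.\<close>

definition christoffel ::
  "('x, 'e::euclidean_space) riem \<Rightarrow> ('x, 'e) chart \<Rightarrow> 'x \<Rightarrow> 'e \<Rightarrow> 'e \<Rightarrow> 'e" where
  "christoffel M \<kappa> x u v = (THE z. \<forall>w. met M \<kappa> x [z, w] =
     (pd \<kappa> (\<lambda>y. met M \<kappa> y [v, w]) x u + pd \<kappa> (\<lambda>y. met M \<kappa> y [u, w]) x v
        - pd \<kappa> (\<lambda>y. met M \<kappa> y [u, v]) x w) / 2)"

text \<open>The covariant derivative; the new slot is the first one.\<close>

definition cov_deriv ::
  "('x, 'e::euclidean_space) riem \<Rightarrow> ('x, 'e, 'v::real_normed_vector) tfield \<Rightarrow> ('x, 'e, 'v) tfield"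
  where
  "cov_deriv M T \<kappa> x vs = (case vs of [] \<Rightarrow> 0 | v # ws \<Rightarrow>
     pd \<kappa> (\<lambda>y. T \<kappa> y ws) x v
       - (\<Sum>j<length ws. T \<kappa> x (ws[j := christoffel M \<kappa> x v (ws ! j)])))"

definition parallel_form ::
  "('x, 'e::euclidean_space) riem \<Rightarrow> nat \<Rightarrow> ('x, 'e, 'v::real_normed_vector) tfield \<Rightarrow> bool" where
  "parallel_form M k T \<longleftrightarrow> form_on M k T \<and>
     (\<forall>\<kappa>\<in>atlas M. \<forall>x\<in>fst \<kappa>. \<forall>vs. length vs = Suc k \<longrightarrow> cov_deriv M T \<kappa> x vs = 0)"

definition velocity :: "('x, 'e::euclidean_space) chart \<Rightarrow> (real \<Rightarrow> 'x) \<Rightarrow> real \<Rightarrow> 'e" where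
  "velocity \<kappa> \<gamma> t = vector_derivative (snd \<kappa> \<circ> \<gamma>) (at t within {0..1})"

definition C1_curve ::
  "('x::topological_space, 'e::euclidean_space) riem \<Rightarrow> (real \<Rightarrow> 'x) \<Rightarrow> bool" where
  "C1_curve M \<gamma> \<longleftrightarrow> continuous_on {0..1} \<gamma> \<and> \<gamma> ` {0..1} \<subseteq> carr M \<and>
     (\<forall>\<kappa>\<in>atlas M. let I = {t \<in> {0..1}. \<gamma> t \<in> fst \<kappa>} in
        (\<forall>t\<in>I. (snd \<kappa> \<circ> \<gamma>) differentiable (at t within {0..1})) \<and>
        continuous_on I (velocity \<kappa> \<gamma>))"

definition curve_length :: "('x, 'e::euclidean_space) riem \<Rightarrow> (real \<Rightarrow> 'x) \<Rightarrow> real" where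
  "curve_length M \<gamma> = integral {0..1} (\<lambda>t. let \<kappa> = chart_at M (\<gamma> t) in
     sqrt (met M \<kappa> (\<gamma> t) [velocity \<kappa> \<gamma> t, velocity \<kappa> \<gamma> t]))"

definition rdist ::
  "('x::topological_space, 'e::euclidean_space) riem \<Rightarrow> 'x \<Rightarrow> 'x \<Rightarrow> real" where
  "rdist M x y = Inf {curve_length M \<gamma> |\<gamma>. C1_curve M \<gamma> \<and> \<gamma> 0 = x \<and> \<gamma> 1 = y}"

definition gball ::
  "('x::topological_space, 'e::euclidean_space) riem \<Rightarrow> 'x \<Rightarrow> real \<Rightarrow> 'x set" where
  "gball M x r = {y \<in> carr M. rdist M x y < r}"

definition complete_riem :: "('x::topological_space, 'e::euclidean_space) riem \<Rightarrow> bool" where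
  "complete_riem M \<longleftrightarrow> (\<forall>s::nat \<Rightarrow> 'x. range s \<subseteq> carr M \<and>
     (\<forall>\<epsilon>>0. \<exists>N. \<forall>j\<ge>N. \<forall>k\<ge>N. rdist M (s j) (s k) < \<epsilon>) \<longrightarrow> (\<exists>l\<in>carr M. s \<longlonglongrightarrow> l))"

definition gram_det :: "('e::euclidean_space list \<Rightarrow> real) \<Rightarrow> real" where
  "gram_det G = (\<Sum>p | p permutes (Basis :: 'e set). of_int (sign p) * (\<Prod>b\<in>Basis. G [b, p b]))"

text \<open>The Riemannian measure of a manifold that exhausts its type (used only in that case).\<close>

definition riem_measure :: "('x::topological_space, 'e::euclidean_space) riem \<Rightarrow> 'x measure" where
  "riem_measure M = (THE \<mu>. sets \<mu> = sets borel \<and>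
     (\<forall>\<kappa>\<in>atlas M. \<forall>B\<in>sets borel. B \<subseteq> fst \<kappa> \<longrightarrow>
        emeasure \<mu> B = (\<integral>\<^sup>+p\<in>snd \<kappa> ` B. ennreal (sqrt (gram_det (met M \<kappa> (cinv \<kappa> p)))) \<partial>lborel)))"

definition form_integral :: "('x::topological_space, 'e::euclidean_space) riem \<Rightarrow> ('x, 'e, real) tfield \<Rightarrow> real"
  where
  "form_integral M a = (LINT x|riem_measure M. (let \<kappa> = chart_at M x in
     THE c. \<forall>vs. length vs = DIM('e) \<longrightarrow> a \<kappa> x vs = c * volf M \<kappa> x vs))"

text \<open>Integrals over the geodesic spheres \<open>\<partial>B\<^sub>r(x)\<close> are with respect to the \<open>(n - 1)\<close>-dimensional
  Hausdorff measure of the Riemannian distance, normalised so as to be the area on smooth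
  hypersurfaces.\<close>

definition rdiam :: "('x::topological_space, 'e::euclidean_space) riem \<Rightarrow> 'x set \<Rightarrow> ennreal" where
  "rdiam M C = (SUP z\<in>C \<times> C. ennreal (rdist M (fst z) (snd z)))"

definition hausdorff_outer ::
  "('x::topological_space, 'e::euclidean_space) riem \<Rightarrow> nat \<Rightarrow> 'x set \<Rightarrow> ennreal" where
  "hausdorff_outer M s S = (SUP \<delta>\<in>{0<..}. INF C\<in>{C :: nat \<Rightarrow> 'x set.
       S \<subseteq> (\<Union>j. C j) \<and> (\<forall>j. rdiam M (C j) \<le> ennreal \<delta>)}.
     (\<Sum>j. ennreal (unit_ball_vol (real s)) * (rdiam M (C j) / 2) ^ s))"

definition hausdorff_measure ::
  "('x::topological_space, 'e::euclidean_space) riem \<Rightarrow> nat \<Rightarrow> 'x measure" where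
  "hausdorff_measure M s = measure_of UNIV (sets borel) (hausdorff_outer M s)"

text \<open>The outward unit normal \<open>\<partial>\<^bsub>r\<^sub>x\<^esub>\<close> of \<open>\<partial>B\<^sub>r(x)\<close> at \<open>y\<close>: the gradient of the distance from \<open>x\<close>.\<close>

definition radial_normal ::
  "('x::topological_space, 'e::euclidean_space) riem \<Rightarrow> 'x \<Rightarrow> ('x, 'e) chart \<Rightarrow> 'x \<Rightarrow> 'e" where
  "radial_normal M x \<kappa> y = (THE z. \<forall>w. met M \<kappa> y [z, w] = pd \<kappa> (rdist M x) y w)"

section \<open>Special holonomy and asymptotically conical geometry\<close>

datatype ('x, 'e) special_structure =
    G2 "('x, 'e, real) tfield"
  | SU3 "('x, 'e, real) tfield" "('x, 'e, complex) tfield"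

definition adapted_basis ::
  "('x, 'e::euclidean_space) riem \<Rightarrow> ('x, 'e) chart \<Rightarrow> 'x \<Rightarrow> 'e list \<Rightarrow> bool" where
  "adapted_basis M \<kappa> x es \<longleftrightarrow>
     length es = DIM('e) \<and> orthobasis (met M \<kappa> x) (set es) \<and> volf M \<kappa> x es = 1"

text \<open>Components (indices from 0) of the model forms
  \<open>\<phi>\<^sub>0 = e\<^sup>1\<^sup>2\<^sup>3 + e\<^sup>1\<^sup>4\<^sup>5 + e\<^sup>1\<^sup>6\<^sup>7 + e\<^sup>2\<^sup>4\<^sup>6 - e\<^sup>2\<^sup>5\<^sup>7 - e\<^sup>3\<^sup>4\<^sup>7 - e\<^sup>3\<^sup>5\<^sup>6\<close>,
  \<open>\<omega>\<^sub>0 = e\<^sup>1\<^sup>2 + e\<^sup>3\<^sup>4 + e\<^sup>5\<^sup>6\<close> and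
  \<open>\<Omega>\<^sub>0 = (e\<^sup>1 + i e\<^sup>2) \<and> (e\<^sup>3 + i e\<^sup>4) \<and> (e\<^sup>5 + i e\<^sup>6)\<close>.\<close>

definition phi0 :: "nat \<Rightarrow> nat \<Rightarrow> nat \<Rightarrow> real" where
  "phi0 i j k =
     (if (i, j, k) \<in> {(0,1,2), (0,3,4), (0,5,6), (1,3,5)} then 1
      else if (i, j, k) \<in> {(1,4,6), (2,3,6), (2,4,5)} then -1 else 0)"

definition omega0 :: "nat \<Rightarrow> nat \<Rightarrow> real" where
  "omega0 i j = (if (i, j) \<in> {(0,1), (2,3), (4,5)} then 1 else 0)"

definition Omega0 :: "nat \<Rightarrow> nat \<Rightarrow> nat \<Rightarrow> complex" where
  "Omega0 i j k =
     (if (i, j, k) = (0,2,4) then 1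
      else if (i, j, k) \<in> {(0,3,5), (1,2,5), (1,3,4)} then -1
      else if (i, j, k) \<in> {(0,2,5), (0,3,4), (1,2,4)} then \<i>
      else if (i, j, k) = (1,3,5) then -\<i> else 0)"

text \<open>A torsion-free \<open>G\<^sub>2\<close>- or \<open>SU(3)\<close>-structure inducing the given metric and orientation:
  the forms are pointwise isomorphic to the model forms and parallel.\<close>

fun torsion_free_structure ::
  "('x, 'e::euclidean_space) riem \<Rightarrow> ('x, 'e) special_structure \<Rightarrow> bool" where
  "torsion_free_structure M (G2 \<phi>) \<longleftrightarrow> DIM('e) = 7 \<and> parallel_form M 3 \<phi> \<and>
     (\<forall>\<kappa>\<in>atlas M. \<forall>x\<in>fst \<kappa>. \<exists>es. adapted_basis M \<kappa> x es \<and>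
        (\<forall>i j k. i < j \<and> j < k \<and> k < 7 \<longrightarrow> \<phi> \<kappa> x [es ! i, es ! j, es ! k] = phi0 i j k))"
| "torsion_free_structure M (SU3 \<omega> \<Omega>) \<longleftrightarrow> DIM('e) = 6 \<and> parallel_form M 2 \<omega> \<and> parallel_form M 3 \<Omega> \<and>
     (\<forall>\<kappa>\<in>atlas M. \<forall>x\<in>fst \<kappa>. \<exists>es. adapted_basis M \<kappa> x es \<and>
        (\<forall>i j. i < j \<and> j < 6 \<longrightarrow> \<omega> \<kappa> x [es ! i, es ! j] = omega0 i j) \<and>
        (\<forall>i j k. i < j \<and> j < k \<and> k < 6 \<longrightarrow> \<Omega> \<kappa> x [es ! i, es ! j, es ! k] = Omega0 i j k))"

fun Theta :: "('x, 'e::euclidean_space) riem \<Rightarrow> ('x, 'e) special_structure \<Rightarrow> ('x, 'e, real) tfield"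
  where
  "Theta M (G2 \<phi>) = (\<lambda>\<kappa> x. hodge (met M \<kappa> x) (volf M \<kappa> x) 3 (\<phi> \<kappa> x))"
| "Theta M (SU3 \<omega> \<Omega>) = (\<lambda>\<kappa> x vs. Re (\<Omega> \<kappa> x vs))"

text \<open>The cone \<open>(1,\<infinity>) \<times> \<Sigma>\<close> with \<open>g\<^sub>C = dr\<^sup>2 + r\<^sup>2 g\<^sub>\<Sigma>\<close> and volume form \<open>r\<^sup>n\<^sup>-\<^sup>1 dr \<and> vol\<^sub>\<Sigma>\<close>.  Its charts are
  the products with charts of the link, and \<open>link_chart\<close> recovers the latter.\<close>

definition cone_chart :: "('y, 's) chart \<Rightarrow> (real \<times> 'y, real \<times> 's) chart" where
  "cone_chart \<kappa> = ({1<..} \<times> fst \<kappa>, \<lambda>z. (fst z, snd \<kappa> (snd z)))"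

definition link_chart :: "(real \<times> 'y, real \<times> 's) chart \<Rightarrow> ('y, 's) chart" where
  "link_chart \<kappa> = (snd ` fst \<kappa>, \<lambda>y. snd (snd \<kappa> (2, y)))"

definition cone :: "('y, 's::euclidean_space) riem \<Rightarrow> (real \<times> 'y, real \<times> 's) riem" where
  "cone L = \<lparr> atlas = cone_chart ` atlas L,
     met = (\<lambda>\<kappa> z vs. fst (vs ! 0) * fst (vs ! 1)
        + (fst z)\<^sup>2 * met L (link_chart \<kappa>) (snd z) [snd (vs ! 0), snd (vs ! 1)]),
     volf = (\<lambda>\<kappa> z vs. fst z ^ DIM('s) *
        wedge 1 DIM('s) (\<lambda>us. fst (us ! 0)) (\<lambda>us. volf L (link_chart \<kappa>) (snd z) (map snd us)) vs) \<rparr>"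

text \<open>\<open>\<delta>\<^sub>t\<^sup>* T = t\<^sup>k T\<close> for the dilations \<open>\<delta>\<^sub>t(r, y) = (tr, y)\<close>.\<close>

definition homogeneous ::
  "('y, 's::euclidean_space) riem \<Rightarrow> nat \<Rightarrow> (real \<times> 'y, real \<times> 's, 'v::real_vector) tfield \<Rightarrow> bool" where
  "homogeneous L k T \<longleftrightarrow> (\<forall>\<kappa>\<in>atlas (cone L). \<forall>z\<in>fst \<kappa>. \<forall>t. t * fst z > 1 \<longrightarrow>
     (\<forall>vs. length vs = k \<longrightarrow>
        T \<kappa> (t * fst z, snd z) (map (\<lambda>v. (t * fst v, snd v)) vs) = t ^ k *\<^sub>R T \<kappa> z vs))"

text \<open>\<open>|D\<^sub>C\<^sup>j T| = O(r\<^sup>\<nu>\<^sup>-\<^sup>j)\<close> for all \<open>j\<close>.\<close>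

definition conical_decay ::
  "('y, 's::euclidean_space) riem \<Rightarrow> real \<Rightarrow> nat \<Rightarrow>
     (real \<times> 'y, real \<times> 's, 'v::real_inner) tfield \<Rightarrow> bool" where
  "conical_decay L \<nu> k T \<longleftrightarrow> (\<forall>j::nat. \<exists>C R. \<forall>r y. 1 < r \<and> R \<le> r \<and> y \<in> carr L \<longrightarrow>
     (let \<kappa> = chart_at (cone L) (r, y) in
        sqrt (tensor_norm2 (met (cone L) \<kappa> (r, y)) (\<bullet>) (j + k)
                ((cov_deriv (cone L) ^^ j) T \<kappa> (r, y))) \<le> C * r powr (\<nu> - real j)))"

definition asymptotic_to ::
  "('x, 'e::euclidean_space) riem \<Rightarrow> ('y, 's::euclidean_space) riem \<Rightarrow> (real \<times> 'y \<Rightarrow> 'x) \<Rightarrow> real \<Rightarrow> nat \<Rightarrow>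
     ('x, 'e, 'v::real_inner) tfield \<Rightarrow> (real \<times> 'y, real \<times> 's, 'v) tfield \<Rightarrow> bool" where
  "asymptotic_to X L \<Upsilon> \<nu> k T T\<^sub>C \<longleftrightarrow>
     conical_decay L \<nu> k (\<lambda>\<kappa> z vs. pullback X \<Upsilon> T \<kappa> z vs - T\<^sub>C \<kappa> z vs)"

fun asymptotic_structure ::
  "('x, 'e::euclidean_space) riem \<Rightarrow> ('y, 's::euclidean_space) riem \<Rightarrow> (real \<times> 'y \<Rightarrow> 'x) \<Rightarrow> real \<Rightarrow>
     ('x, 'e) special_structure \<Rightarrow> (real \<times> 'y, real \<times> 's) special_structure \<Rightarrow> bool" where
  "asymptotic_structure X L \<Upsilon> \<nu> (G2 \<phi>) (G2 \<phi>\<^sub>C) \<longleftrightarrow>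
     homogeneous L 3 \<phi>\<^sub>C \<and> asymptotic_to X L \<Upsilon> \<nu> 3 \<phi> \<phi>\<^sub>C"
| "asymptotic_structure X L \<Upsilon> \<nu> (SU3 \<omega> \<Omega>) (SU3 \<omega>\<^sub>C \<Omega>\<^sub>C) \<longleftrightarrow>
     homogeneous L 2 \<omega>\<^sub>C \<and> homogeneous L 3 \<Omega>\<^sub>C \<and>
     asymptotic_to X L \<Upsilon> \<nu> 2 \<omega> \<omega>\<^sub>C \<and> asymptotic_to X L \<Upsilon> \<nu> 3 \<Omega> \<Omega>\<^sub>C"
| "asymptotic_structure X L \<Upsilon> \<nu> _ _ \<longleftrightarrow> False"

definition one_ended :: "'x::topological_space itself \<Rightarrow> bool" where
  "one_ended _ \<longleftrightarrow> (\<forall>K::'x set. compact K \<longrightarrow>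
     (\<exists>!C. C \<in> components (- K) \<and> \<not> compact (closure C)))"

text \<open>\<open>X\<close> is a complete connected noncompact one-ended AC manifold with torsion-free structure \<open>S\<close>,
  with link \<open>L\<close>, with end identified by \<open>\<Upsilon>\<close> with the cone, and asymptotic to the conical
  structure \<open>S\<^sub>C\<close>.  The manifolds \<open>X\<close> and \<open>L\<close> exhaust their types.\<close>

definition ac_special_holonomy ::
  "('x::{t2_space,second_countable_topology}, 'e::euclidean_space) riem \<Rightarrow> ('x, 'e) special_structure \<Rightarrow>
     ('y::{t2_space,second_countable_topology}, 's::euclidean_space) riem \<Rightarrow>
     (real \<times> 'y, real \<times> 's) special_structure \<Rightarrow> (real \<times> 'y \<Rightarrow> 'x) \<Rightarrow> bool" where
  "ac_special_holonomy X S L S\<^sub>C \<Upsilon> \<longleftrightarrow>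
     oriented_riem X \<and> carr X = UNIV \<and> complete_riem X \<and>
     connected (UNIV :: 'x set) \<and> \<not> compact (UNIV :: 'x set) \<and> one_ended TYPE('x) \<and>
     torsion_free_structure X S \<and>
     oriented_riem L \<and> carr L = UNIV \<and> compact (UNIV :: 'y set) \<and> DIM('e) = Suc DIM('s) \<and>
     torsion_free_structure (cone L) S\<^sub>C \<and>
     (\<exists>K. compact K \<and> bij_betw \<Upsilon> ({1<..} \<times> UNIV) (- K) \<and>
        smooth_mfd_map (cone L) X ({1<..} \<times> UNIV) \<Upsilon> \<and>
        smooth_mfd_map X (cone L) (- K) (inv_into ({1<..} \<times> UNIV) \<Upsilon>)) \<and>
     (\<exists>\<nu><0. asymptotic_to X L \<Upsilon> \<nu> 2 (met X) (met (cone L)) \<and>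
        asymptotic_structure X L \<Upsilon> \<nu> S S\<^sub>C)"

text \<open>\<open>\<rho>\<close> extends \<open>r\<close> in the sense that it agrees with \<open>r\<close> far out on the end.  (Agreement on the
  entire end \<open>r > 1\<close> is in general incompatible with smoothness and \<open>\<rho> \<ge> 1\<close>.)\<close>

definition radius_function ::
  "('x, 'e::euclidean_space) riem \<Rightarrow> (real \<times> 'y \<Rightarrow> 'x) \<Rightarrow> ('x \<Rightarrow> real) \<Rightarrow> bool" where
  "radius_function X \<Upsilon> \<rho> \<longleftrightarrow> smooth_fun X UNIV \<rho> \<and> (\<forall>x. \<rho> x \<ge> 1) \<and>
     (\<exists>R. \<forall>r y. 1 < r \<and> R \<le> r \<longrightarrow> \<rho> (\<Upsilon> (r, y)) = r)"

section \<open>Gauge theory\<close>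

datatype gauge_kind = gauge_SU2 | gauge_SO3

text \<open>Both groups are realised by complex matrices; elements of \<open>SO(3)\<close> have real entries.\<close>

type_synonym 'm cmat = "complex ^ 'm ^ 'm"

fun matrix_size :: "gauge_kind \<Rightarrow> nat" where
  "matrix_size gauge_SU2 = 2"
| "matrix_size gauge_SO3 = 3"

definition ctranspose :: "('m::finite) cmat \<Rightarrow> 'm cmat" where
  "ctranspose a = (\<chi> i j. cnj (a $ j $ i))"

fun gauge_group :: "gauge_kind \<Rightarrow> ('m::finite) cmat set" where
  "gauge_group gauge_SU2 = {a. ctranspose a ** a = mat 1 \<and> det a = 1}"
| "gauge_group gauge_SO3 = {a. (\<forall>i j. a $ i $ j \<in> \<real>) \<and> transpose a ** a = mat 1 \<and> det a = 1}"

fun gauge_algebra :: "gauge_kind \<Rightarrow> ('m::finite) cmat set" where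
  "gauge_algebra gauge_SU2 = {a. ctranspose a = - a \<and> trace a = 0}"
| "gauge_algebra gauge_SO3 = {a. (\<forall>i j. a $ i $ j \<in> \<real>) \<and> transpose a = - a}"

fun gip :: "gauge_kind \<Rightarrow> ('m::finite) cmat \<Rightarrow> 'm cmat \<Rightarrow> real" where
  "gip gauge_SU2 a b = - 2 * Re (trace (a ** b))"
| "gip gauge_SO3 a b = - (1 / 2) * Re (trace (a ** b))"

definition lie_bracket :: "('m::finite) cmat \<Rightarrow> 'm cmat \<Rightarrow> 'm cmat" where
  "lie_bracket a b = a ** b - b ** a"

text \<open>A principal bundle is given by local gauges \<open>s\<^sub>\<alpha>\<close> over open sets with transition functions,
  \<open>s\<^sub>\<beta> = s\<^sub>\<alpha> t\<^sub>\<alpha>\<^sub>\<beta>\<close>.\<close>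

record ('a, 'x, 'm) gbundle =
  gauges :: "'a set"
  gdom :: "'a \<Rightarrow> 'x set"
  trans_fun :: "'a \<Rightarrow> 'a \<Rightarrow> 'x \<Rightarrow> 'm cmat"

definition principal_bundle ::
  "gauge_kind \<Rightarrow> ('x::topological_space, 'e::euclidean_space) riem \<Rightarrow> ('a, 'x, 'm::finite) gbundle \<Rightarrow> bool"
  where
  "principal_bundle G M P \<longleftrightarrow>
     (\<forall>\<alpha>\<in>gauges P. open (gdom P \<alpha>)) \<and> (\<Union>\<alpha>\<in>gauges P. gdom P \<alpha>) = carr M \<and>
     (\<forall>\<alpha>\<in>gauges P. \<forall>\<beta>\<in>gauges P.
        smooth_fun M (gdom P \<alpha> \<inter> gdom P \<beta>) (trans_fun P \<alpha> \<beta>) \<and>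
        (\<forall>x\<in>gdom P \<alpha> \<inter> gdom P \<beta>. trans_fun P \<alpha> \<beta> x \<in> gauge_group G)) \<and>
     (\<forall>\<alpha>\<in>gauges P. \<forall>x\<in>gdom P \<alpha>. trans_fun P \<alpha> \<alpha> x = mat 1) \<and>
     (\<forall>\<alpha>\<in>gauges P. \<forall>\<beta>\<in>gauges P. \<forall>\<gamma>\<in>gauges P. \<forall>x\<in>gdom P \<alpha> \<inter> gdom P \<beta> \<inter> gdom P \<gamma>.
        trans_fun P \<alpha> \<beta> x ** trans_fun P \<beta> \<gamma> x = trans_fun P \<alpha> \<gamma> x)"

definition gauge_at :: "('a, 'x, 'm) gbundle \<Rightarrow> 'x \<Rightarrow> 'a" where
  "gauge_at P x = (SOME \<alpha>. \<alpha> \<in> gauges P \<and> x \<in> gdom P \<alpha>)"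

type_synonym ('a, 'x, 'e, 'm) connection = "'a \<Rightarrow> ('x, 'e, 'm cmat) tfield"
type_synonym ('a, 'x, 'm) higgs = "'a \<Rightarrow> 'x \<Rightarrow> 'm cmat"

definition connection_on ::
  "gauge_kind \<Rightarrow> ('x, 'e::euclidean_space) riem \<Rightarrow> ('a, 'x, 'm::finite) gbundle \<Rightarrow>
     ('a, 'x, 'e, 'm) connection \<Rightarrow> bool" where
  "connection_on G M P A \<longleftrightarrow>
     (\<forall>\<alpha>\<in>gauges P. tensor_on M (gdom P \<alpha>) 1 (A \<alpha>) \<and>
        (\<forall>\<kappa>\<in>atlas M. \<forall>x\<in>fst \<kappa> \<inter> gdom P \<alpha>. \<forall>v. A \<alpha> \<kappa> x [v] \<in> gauge_algebra G)) \<and>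
     (\<forall>\<alpha>\<in>gauges P. \<forall>\<beta>\<in>gauges P. \<forall>\<kappa>\<in>atlas M. \<forall>x\<in>fst \<kappa> \<inter> gdom P \<alpha> \<inter> gdom P \<beta>. \<forall>v.
        A \<beta> \<kappa> x [v] = trans_fun P \<beta> \<alpha> x ** A \<alpha> \<kappa> x [v] ** trans_fun P \<alpha> \<beta> x
          + trans_fun P \<beta> \<alpha> x ** pd \<kappa> (trans_fun P \<alpha> \<beta>) x v)"

definition higgs_on ::
  "gauge_kind \<Rightarrow> ('x, 'e::euclidean_space) riem \<Rightarrow> ('a, 'x, 'm::finite) gbundle \<Rightarrow>
     ('a, 'x, 'm) higgs \<Rightarrow> bool" where
  "higgs_on G M P \<Phi> \<longleftrightarrow>
     (\<forall>\<alpha>\<in>gauges P. smooth_fun M (gdom P \<alpha>) (\<Phi> \<alpha>) \<and> (\<forall>x\<in>gdom P \<alpha>. \<Phi> \<alpha> x \<in> gauge_algebra G)) \<and>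
     (\<forall>\<alpha>\<in>gauges P. \<forall>\<beta>\<in>gauges P. \<forall>x\<in>gdom P \<alpha> \<inter> gdom P \<beta>.
        \<Phi> \<beta> x = trans_fun P \<beta> \<alpha> x ** \<Phi> \<alpha> x ** trans_fun P \<alpha> \<beta> x)"

definition curvature ::
  "('a, 'x, 'e::euclidean_space, 'm::finite) connection \<Rightarrow> 'a \<Rightarrow> ('x, 'e, 'm cmat) tfield" where
  "curvature A \<alpha> \<kappa> x vs =
     pd \<kappa> (\<lambda>y. A \<alpha> \<kappa> y [vs ! 1]) x (vs ! 0) - pd \<kappa> (\<lambda>y. A \<alpha> \<kappa> y [vs ! 0]) x (vs ! 1)
       + lie_bracket (A \<alpha> \<kappa> x [vs ! 0]) (A \<alpha> \<kappa> x [vs ! 1])"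

definition cov_higgs ::
  "('a, 'x, 'e::euclidean_space, 'm::finite) connection \<Rightarrow> ('a, 'x, 'm) higgs \<Rightarrow> 'a \<Rightarrow>
     ('x, 'e, 'm cmat) tfield" where
  "cov_higgs A \<Phi> \<alpha> \<kappa> x vs = pd \<kappa> (\<Phi> \<alpha>) x (vs ! 0) + lie_bracket (A \<alpha> \<kappa> x [vs ! 0]) (\<Phi> \<alpha> x)"

text \<open>Squared pointwise norm of a \<open>k\<close>-form with values in the adjoint bundle.\<close>

definition ad_norm2 ::
  "gauge_kind \<Rightarrow> ('x, 'e::euclidean_space) riem \<Rightarrow> ('a, 'x, 'm::finite) gbundle \<Rightarrow> nat \<Rightarrow>
     ('a \<Rightarrow> ('x, 'e, 'm cmat) tfield) \<Rightarrow> 'x \<Rightarrow> real" where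
  "ad_norm2 G M P k T x = (let \<kappa> = chart_at M x in
     form_norm2 (met M \<kappa> x) (gip G) k (T (gauge_at P x) \<kappa> x))"

definition higgs_norm ::
  "gauge_kind \<Rightarrow> ('a, 'x, 'm::finite) gbundle \<Rightarrow> ('a, 'x, 'm) higgs \<Rightarrow> 'x \<Rightarrow> real" where
  "higgs_norm G P \<Phi> x = (let a = \<Phi> (gauge_at P x) x in sqrt (gip G a a))"

definition curv_wedge_Theta ::
  "('x, 'e::euclidean_space) riem \<Rightarrow> ('x, 'e) special_structure \<Rightarrow>
     ('a, 'x, 'e, 'm::finite) connection \<Rightarrow> 'a \<Rightarrow> ('x, 'e, 'm cmat) tfield" where
  "curv_wedge_Theta X S A \<alpha> \<kappa> x = wedge 2 (DIM('e) - 3) (curvature A \<alpha> \<kappa> x) (Theta X S \<kappa> x)"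

fun su3_condition ::
  "('x, 'e::euclidean_space) riem \<Rightarrow> ('x, 'e) special_structure \<Rightarrow> ('a, 'x, 'm::finite) gbundle \<Rightarrow>
     ('a, 'x, 'e, 'm) connection \<Rightarrow> bool" where
  "su3_condition X (G2 \<phi>) P A \<longleftrightarrow> True"
| "su3_condition X (SU3 \<omega> \<Omega>) P A \<longleftrightarrow>
     (\<forall>\<alpha>\<in>gauges P. \<forall>\<kappa>\<in>atlas X. \<forall>x\<in>fst \<kappa> \<inter> gdom P \<alpha>. \<forall>vs. length vs = 6 \<longrightarrow>
        wedge 2 4 (curvature A \<alpha> \<kappa> x) (wedge 2 2 (\<omega> \<kappa> x) (\<omega> \<kappa> x)) vs = 0)"

definition Theta_monopole ::
  "gauge_kind \<Rightarrow> ('x, 'e::euclidean_space) riem \<Rightarrow> ('x, 'e) special_structure \<Rightarrow>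
     ('a, 'x, 'm::finite) gbundle \<Rightarrow> ('a, 'x, 'e, 'm) connection \<Rightarrow> ('a, 'x, 'm) higgs \<Rightarrow> bool" where
  "Theta_monopole G X S P A \<Phi> \<longleftrightarrow> connection_on G X P A \<and> higgs_on G X P \<Phi> \<and>
     (\<forall>\<alpha>\<in>gauges P. \<forall>\<kappa>\<in>atlas X. \<forall>x\<in>fst \<kappa> \<inter> gdom P \<alpha>. \<forall>vs. length vs = DIM('e) - 1 \<longrightarrow>
        curv_wedge_Theta X S A \<alpha> \<kappa> x vs
          = hodge (met X \<kappa> x) (volf X \<kappa> x) 1 (cov_higgs A \<Phi> \<alpha> \<kappa> x) vs) \<and>
     su3_condition X S P A"

definition irreducible_pair ::
  "('x, 'e::euclidean_space) riem \<Rightarrow> ('a, 'x, 'm::finite) gbundle \<Rightarrow>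
     ('a, 'x, 'e, 'm) connection \<Rightarrow> ('a, 'x, 'm) higgs \<Rightarrow> bool" where
  "irreducible_pair X P A \<Phi> \<longleftrightarrow>
     (\<exists>\<alpha>\<in>gauges P. \<exists>\<kappa>\<in>atlas X. \<exists>x\<in>fst \<kappa> \<inter> gdom P \<alpha>. \<exists>v. cov_higgs A \<Phi> \<alpha> \<kappa> x [v] \<noteq> 0)"

definition intermediate_energy ::
  "gauge_kind \<Rightarrow> ('x::topological_space, 'e::euclidean_space) riem \<Rightarrow> ('x, 'e) special_structure \<Rightarrow>
     ('a, 'x, 'm::finite) gbundle \<Rightarrow> ('a, 'x, 'e, 'm) connection \<Rightarrow> ('a, 'x, 'm) higgs \<Rightarrow> ennreal" where
  "intermediate_energy G X S P A \<Phi> = (\<integral>\<^sup>+x. ennreal (1 / 2 *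
     (ad_norm2 G X P (DIM('e) - 1) (curv_wedge_Theta X S A) x
        + ad_norm2 G X P 1 (cov_higgs A \<Phi>) x)) \<partial>riem_measure X)"

definition quadratic_curvature_decay ::
  "gauge_kind \<Rightarrow> ('x, 'e::euclidean_space) riem \<Rightarrow> ('x \<Rightarrow> real) \<Rightarrow> ('a, 'x, 'm::finite) gbundle \<Rightarrow>
     ('a, 'x, 'e, 'm) connection \<Rightarrow> bool" where
  "quadratic_curvature_decay G X \<rho> P A \<longleftrightarrow> (\<exists>C R. \<forall>x. \<rho> x \<ge> R \<longrightarrow>
     sqrt (ad_norm2 G X P 2 (curvature A) x) \<le> C * (\<rho> x) powr (-2))"

definition has_mass ::
  "gauge_kind \<Rightarrow> ('x \<Rightarrow> real) \<Rightarrow> ('a, 'x, 'm::finite) gbundle \<Rightarrow> ('a, 'x, 'm) higgs \<Rightarrow> real \<Rightarrow> bool" where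
  "has_mass G \<rho> P \<Phi> m \<longleftrightarrow> m > 0 \<and>
     (\<forall>\<epsilon>>0. \<exists>R. \<forall>x. \<rho> x \<ge> R \<longrightarrow> \<bar>higgs_norm G P \<Phi> x - m\<bar> < \<epsilon>)"

section \<open>Limits at infinity and the monopole class\<close>

text \<open>The slice \<open>{\<rho> = R}\<close>, for large \<open>R\<close>, is parametrised by the link.\<close>

definition slice :: "(real \<times> 'y \<Rightarrow> 'x) \<Rightarrow> real \<Rightarrow> 'y \<Rightarrow> 'x" where
  "slice \<Upsilon> R y = \<Upsilon> (R, y)"

text \<open>Isomorphism from \<open>Q\<close> to the pull-back \<open>j\<^sup>* P\<close>, sending the gauge \<open>s\<^sub>\<beta>\<close> of \<open>Q\<close> to
  \<open>s\<^sub>\<alpha> h\<^sub>\<beta>\<^sub>\<alpha>\<close>.\<close>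

definition bundle_iso ::
  "gauge_kind \<Rightarrow> ('y, 's::euclidean_space) riem \<Rightarrow> ('b, 'y, 'm::finite) gbundle \<Rightarrow> ('y \<Rightarrow> 'x) \<Rightarrow>
     ('a, 'x, 'm) gbundle \<Rightarrow> ('b \<Rightarrow> 'a \<Rightarrow> 'y \<Rightarrow> 'm cmat) \<Rightarrow> bool" where
  "bundle_iso G L Q j P h \<longleftrightarrow>
     (\<forall>\<beta>\<in>gauges Q. \<forall>\<alpha>\<in>gauges P. smooth_fun L (gdom Q \<beta> \<inter> j -` gdom P \<alpha>) (h \<beta> \<alpha>) \<and>
        (\<forall>y\<in>gdom Q \<beta> \<inter> j -` gdom P \<alpha>. h \<beta> \<alpha> y \<in> gauge_group G)) \<and>
     (\<forall>\<beta>\<in>gauges Q. \<forall>\<beta>'\<in>gauges Q. \<forall>\<alpha>\<in>gauges P. \<forall>\<alpha>'\<in>gauges P.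
        \<forall>y\<in>gdom Q \<beta> \<inter> gdom Q \<beta>' \<inter> j -` (gdom P \<alpha> \<inter> gdom P \<alpha>').
          h \<beta>' \<alpha>' y = trans_fun P \<alpha>' \<alpha> (j y) ** h \<beta> \<alpha> y ** trans_fun Q \<beta> \<beta>' y)"

definition pull_connection ::
  "('x, 'e::euclidean_space) riem \<Rightarrow> ('y \<Rightarrow> 'x) \<Rightarrow> ('a, 'x, 'm::finite) gbundle \<Rightarrow>
     ('b \<Rightarrow> 'a \<Rightarrow> 'y \<Rightarrow> 'm cmat) \<Rightarrow> ('a, 'x, 'e, 'm) connection \<Rightarrow>
     ('b, 'y, 's::euclidean_space, 'm) connection" where
  "pull_connection X j P h A \<beta> \<kappa> y vs = (let \<alpha> = gauge_at P (j y) in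
     ctranspose (h \<beta> \<alpha> y) ** pullback X j (A \<alpha>) \<kappa> y vs ** h \<beta> \<alpha> y
       + ctranspose (h \<beta> \<alpha> y) ** pd \<kappa> (h \<beta> \<alpha>) y (vs ! 0))"

definition pull_higgs ::
  "('y \<Rightarrow> 'x) \<Rightarrow> ('a, 'x, 'm::finite) gbundle \<Rightarrow> ('b \<Rightarrow> 'a \<Rightarrow> 'y \<Rightarrow> 'm cmat) \<Rightarrow>
     ('a, 'x, 'm) higgs \<Rightarrow> ('b, 'y, 'm) higgs" where
  "pull_higgs j P h \<Phi> \<beta> y = (let \<alpha> = gauge_at P (j y) in
     ctranspose (h \<beta> \<alpha> y) ** \<Phi> \<alpha> (j y) ** h \<beta> \<alpha> y)"

definition limit_at_infinity ::
  "gauge_kind \<Rightarrow> ('x::topological_space, 'e::euclidean_space) riem \<Rightarrow>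
     ('y::topological_space, 's::euclidean_space) riem \<Rightarrow> (real \<times> 'y \<Rightarrow> 'x) \<Rightarrow>
     ('a, 'x, 'm::finite) gbundle \<Rightarrow> ('a, 'x, 'e, 'm) connection \<Rightarrow> ('a, 'x, 'm) higgs \<Rightarrow> real \<Rightarrow>
     ('b, 'y, 'm) gbundle \<Rightarrow> ('b, 'y, 's, 'm) connection \<Rightarrow> ('b, 'y, 'm) higgs \<Rightarrow> bool" where
  "limit_at_infinity G X L \<Upsilon> P A \<Phi> m Q Ainf \<Phi>inf \<longleftrightarrow>
     principal_bundle G L Q \<and> connection_on G L Q Ainf \<and> higgs_on G L Q \<Phi>inf \<and>
     (\<forall>\<beta>\<in>gauges Q. \<forall>\<kappa>\<in>atlas L. \<forall>y\<in>fst \<kappa> \<inter> gdom Q \<beta>. \<forall>v. cov_higgs Ainf \<Phi>inf \<beta> \<kappa> y [v] = 0) \<and>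
     (\<forall>y\<in>carr L. higgs_norm G Q \<Phi>inf y = m) \<and>
     (\<exists>h R\<^sub>0. (\<forall>R. 1 < R \<and> R\<^sub>0 \<le> R \<longrightarrow> bundle_iso G L Q (slice \<Upsilon> R) P (h R)) \<and>
        (\<forall>\<epsilon>>0. \<exists>R\<^sub>1. \<forall>R. 1 < R \<and> R\<^sub>1 \<le> R \<longrightarrow> (\<forall>y\<in>carr L.
           sqrt (ad_norm2 G L Q 1 (\<lambda>\<beta> \<kappa> z vs.
              pull_connection X (slice \<Upsilon> R) P (h R) A \<beta> \<kappa> z vs - Ainf \<beta> \<kappa> z vs) y) < \<epsilon> \<and>
           higgs_norm G Q (\<lambda>\<beta> z. pull_higgs (slice \<Upsilon> R) P (h R) \<Phi> \<beta> z - \<Phi>inf \<beta> z) y < \<epsilon>)))"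

text \<open>Chern--Weil representative \<open>1/(2\<pi>) \<langle>F u\<^sub>2, u\<^sub>1\<rangle>\<close> of the Euler class of the plane bundle
  \<open>\<langle>\<Phi>\<rangle>\<^sup>\<perp>\<close> with the (parallel, since \<open>\<nabla>\<Phi> = 0\<close>) induced connection, for an oriented orthonormal
  frame \<open>(u\<^sub>1, u\<^sub>2)\<close>.  In the given norms \<open>\<Phi>/m\<close> acts on \<open>\<langle>\<Phi>\<rangle>\<^sup>\<perp>\<close> as a rotation by a right angle; the
  orientation is \<open>u\<^sub>1 = [\<Phi>, u\<^sub>2]/m\<close>.  Then half of the form equals \<open>\<langle>\<Phi>, F\<rangle>/(4\<pi>m)\<close>, and
  \<open>|\<nabla>\<Phi>|\<^sup>2 vol = d(\<langle>\<Phi>, F\<rangle> \<and> \<Theta>)\<close> for monopoles, so this is the orientation for which the intermediate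
  energy is \<open>4\<pi>m \<langle>\<beta> \<union> \<Theta>\<^sub>\<infinity>, [\<Sigma>]\<rangle>\<close>, with \<open>\<Sigma>\<close> oriented by the outward normal first.\<close>

definition plane_frame ::
  "gauge_kind \<Rightarrow> real \<Rightarrow> ('m::finite) cmat \<Rightarrow> 'm cmat \<times> 'm cmat \<Rightarrow> bool" where
  "plane_frame G m a u \<longleftrightarrow> fst u \<in> gauge_algebra G \<and> snd u \<in> gauge_algebra G \<and>
     gip G (fst u) (fst u) = 1 \<and> gip G (snd u) (snd u) = 1 \<and> gip G (fst u) (snd u) = 0 \<and>
     gip G a (fst u) = 0 \<and> gip G a (snd u) = 0 \<and>
     fst u = (1 / m) *\<^sub>R lie_bracket a (snd u)"

definition euler_form ::
  "gauge_kind \<Rightarrow> ('b, 'y, 'm::finite) gbundle \<Rightarrow> ('b, 'y, 's::euclidean_space, 'm) connection \<Rightarrow>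
     ('b, 'y, 'm) higgs \<Rightarrow> real \<Rightarrow> ('y, 's, real) tfield" where
  "euler_form G Q A \<Phi> m \<kappa> y vs = (let \<beta> = gauge_at Q y; u = (SOME u. plane_frame G m (\<Phi> \<beta> y) u) in
     1 / (2 * pi) * gip G (lie_bracket (curvature A \<beta> \<kappa> y vs) (snd u)) (fst u))"

definition represents_monopole_class ::
  "gauge_kind \<Rightarrow> ('y, 's::euclidean_space) riem \<Rightarrow> ('b, 'y, 'm::finite) gbundle \<Rightarrow>
     ('b, 'y, 's, 'm) connection \<Rightarrow> ('b, 'y, 'm) higgs \<Rightarrow> real \<Rightarrow> ('y, 's, real) tfield \<Rightarrow> bool" where
  "represents_monopole_class G L Q Ainf \<Phi>inf m b \<longleftrightarrow>
     cohomologous L 2 (\<lambda>\<kappa> y vs. 1 / 2 * euler_form G Q Ainf \<Phi>inf m \<kappa> y vs) b"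

definition represents_Theta_infinity ::
  "('x, 'e::euclidean_space) riem \<Rightarrow> ('x, 'e) special_structure \<Rightarrow> ('y, 's::euclidean_space) riem \<Rightarrow>
     (real \<times> 'y \<Rightarrow> 'x) \<Rightarrow> ('y, 's, real) tfield \<Rightarrow> bool" where
  "represents_Theta_infinity X S L \<Upsilon> \<theta> \<longleftrightarrow>
     (\<exists>R\<^sub>0. \<forall>R. 1 < R \<and> R\<^sub>0 \<le> R \<longrightarrow>
        cohomologous L (DIM('e) - 3) (pullback X (slice \<Upsilon> R) (Theta X S)) \<theta>)"

definition cup_pairing ::
  "('y::topological_space, 's::euclidean_space) riem \<Rightarrow> nat \<Rightarrow> nat \<Rightarrow> ('y, 's, real) tfield \<Rightarrow>
     ('y, 's, real) tfield \<Rightarrow> real" where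
  "cup_pairing L p q a b = form_integral L (\<lambda>\<kappa> y. wedge p q (a \<kappa> y) (b \<kappa> y))"

section \<open>Energy densities and monotonicity\<close>

definition curv2 ::
  "gauge_kind \<Rightarrow> ('x, 'e::euclidean_space) riem \<Rightarrow> ('a, 'x, 'm::finite) gbundle \<Rightarrow>
     ('a, 'x, 'e, 'm) connection \<Rightarrow> 'x \<Rightarrow> real" where
  "curv2 G X P A = ad_norm2 G X P 2 (curvature A)"

definition covh2 ::
  "gauge_kind \<Rightarrow> ('x, 'e::euclidean_space) riem \<Rightarrow> ('a, 'x, 'm::finite) gbundle \<Rightarrow>
     ('a, 'x, 'e, 'm) connection \<Rightarrow> ('a, 'x, 'm) higgs \<Rightarrow> 'x \<Rightarrow> real" where
  "covh2 G X P A \<Phi> = ad_norm2 G X P 1 (cov_higgs A \<Phi>)"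

definition e_density ::
  "gauge_kind \<Rightarrow> ('x, 'e::euclidean_space) riem \<Rightarrow> ('a, 'x, 'm::finite) gbundle \<Rightarrow>
     ('a, 'x, 'e, 'm) connection \<Rightarrow> ('a, 'x, 'm) higgs \<Rightarrow> 'x \<Rightarrow> real" where
  "e_density G X P A \<Phi> x = curv2 G X P A x + covh2 G X P A \<Phi> x"

definition q_density ::
  "gauge_kind \<Rightarrow> ('x, 'e::euclidean_space) riem \<Rightarrow> ('a, 'x, 'm::finite) gbundle \<Rightarrow>
     ('a, 'x, 'e, 'm) connection \<Rightarrow> ('a, 'x, 'm) higgs \<Rightarrow> 'x \<Rightarrow> real" where
  "q_density G X P A \<Phi> x = curv2 G X P A x - covh2 G X P A \<Phi> x"

definition theta ::
  "gauge_kind \<Rightarrow> ('x::topological_space, 'e::euclidean_space) riem \<Rightarrow> ('a, 'x, 'm::finite) gbundle \<Rightarrow>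
     ('a, 'x, 'e, 'm) connection \<Rightarrow> ('a, 'x, 'm) higgs \<Rightarrow> real \<Rightarrow> 'x \<Rightarrow> real \<Rightarrow> real" where
  "theta G X P A \<Phi> m x r = inverse m * r powi (3 - int DIM('e)) *
     (LINT y:gball X x r|riem_measure X. e_density G X P A \<Phi> y)"

text \<open>\<open>|\<partial>\<^bsub>r\<^sub>x\<^esub> \<lrcorner> F|\<^sup>2 + |\<nabla>\<^bsub>\<partial>\<^bsub>r\<^sub>x\<^esub>\<^esub> \<Phi>|\<^sup>2\<close>\<close>

definition radial_density ::
  "gauge_kind \<Rightarrow> ('x::topological_space, 'e::euclidean_space) riem \<Rightarrow> ('a, 'x, 'm::finite) gbundle \<Rightarrow>
     ('a, 'x, 'e, 'm) connection \<Rightarrow> ('a, 'x, 'm) higgs \<Rightarrow> 'x \<Rightarrow> 'x \<Rightarrow> real" where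
  "radial_density G X P A \<Phi> x y =
     ad_norm2 G X P 1 (\<lambda>\<alpha> \<kappa> z vs. curvature A \<alpha> \<kappa> z (radial_normal X x \<kappa> z # vs)) y
       + ad_norm2 G X P 0 (\<lambda>\<alpha> \<kappa> z vs. cov_higgs A \<Phi> \<alpha> \<kappa> z [radial_normal X x \<kappa> z]) y"

definition stress_energy_inequality ::
  "gauge_kind \<Rightarrow> ('x::topological_space, 'e::euclidean_space) riem \<Rightarrow> ('a, 'x, 'm::finite) gbundle \<Rightarrow>
     ('a, 'x, 'e, 'm) connection \<Rightarrow> ('a, 'x, 'm) higgs \<Rightarrow> real \<Rightarrow> real \<Rightarrow> real \<Rightarrow> bool" where
  "stress_energy_inequality G X P A \<Phi> m c r\<^sub>0 \<longleftrightarrow>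
     (\<forall>x\<in>carr X. \<forall>r. 0 < r \<and> r \<le> r\<^sub>0 \<longrightarrow>
        (\<exists>D. ((\<lambda>t. exp (c * t\<^sup>2) * theta G X P A \<Phi> m x t) has_real_derivative D)
                (at r within {0<..r\<^sub>0}) \<and>
           D \<ge> 2 * inverse m * exp (c * r\<^sup>2) * r powi (3 - int DIM('e)) *
                 (LINT y:frontier (gball X x r)|hausdorff_measure X (DIM('e) - 1).
                    radial_density G X P A \<Phi> x y)
               - exp (c * r\<^sup>2) * r powi (2 - int DIM('e)) * inverse m *
                 (LINT y:gball X x r|riem_measure X. q_density G X P A \<Phi> y)))"

definition effective_monotonicity ::
  "gauge_kind \<Rightarrow> ('x::topological_space, 'e::euclidean_space) riem \<Rightarrow> ('a, 'x, 'm::finite) gbundle \<Rightarrow>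
     (nat \<Rightarrow> ('a, 'x, 'e, 'm) connection) \<Rightarrow> (nat \<Rightarrow> ('a, 'x, 'm) higgs) \<Rightarrow> (nat \<Rightarrow> real) \<Rightarrow>
     real \<Rightarrow> real \<Rightarrow> 'x set \<Rightarrow> real \<Rightarrow> bool" where
  "effective_monotonicity G X P A \<Phi> m c r\<^sub>0 U \<gamma> \<longleftrightarrow> \<gamma> > 0 \<and>
     (\<exists>A\<^sub>U>0. \<exists>i\<^sub>U. \<forall>i\<ge>i\<^sub>U. \<forall>x\<in>carr X. \<forall>r s. gball X x r \<subseteq> U \<and> 0 < s \<and> s < r \<and> r \<le> r\<^sub>0 \<longrightarrow>
        exp (c * s\<^sup>2) * theta G X P (A i) (\<Phi> i) (m i) x s
          \<le> exp (c * r\<^sup>2) * theta G X P (A i) (\<Phi> i) (m i) x r + A\<^sub>U * r powr \<gamma>)"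

text \<open>The scale-invariant bound \<open>m\<^sub>i\<^sup>-\<^sup>1 s\<^sup>2\<^sup>-\<^sup>n \<integral>\<^bsub>B\<^sub>s(y)\<^esub> f\<^sub>i \<le> \<Lambda>\<close> for nonnegative densities \<open>f\<^sub>i\<close>, on all geodesic
  balls in \<open>U\<close> of radius at most \<open>r\<^sub>0\<close> and for all large \<open>i\<close>.\<close>

definition morrey_bound ::
  "('x::topological_space, 'e::euclidean_space) riem \<Rightarrow> (nat \<Rightarrow> real) \<Rightarrow> real \<Rightarrow> 'x set \<Rightarrow>
     (nat \<Rightarrow> 'x \<Rightarrow> real) \<Rightarrow> bool" where
  "morrey_bound X m r\<^sub>0 U f \<longleftrightarrow>
     (\<exists>\<Lambda>::real. \<exists>i\<^sub>U. \<forall>i\<ge>i\<^sub>U. \<forall>y\<in>carr X. \<forall>s. gball X y s \<subseteq> U \<and> 0 < s \<and> s \<le> r\<^sub>0 \<longrightarrow>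
        ennreal (inverse (m i) * s powi (2 - int DIM('e))) *
          (\<integral>\<^sup>+z\<in>gball X y s. ennreal (f i z) \<partial>riem_measure X) \<le> ennreal \<Lambda>)"

end

theory Submission
  imports Defs
begin

text \<open>
  The boundary term of the stress-energy inequality is nonnegative, and the Morrey bound controls
  the remaining one, so \<open>d/dr (exp (c r\<^sup>2) \<theta>\<^sub>i(x, r)) \<ge> - exp (c r\<^sub>0\<^sup>2) \<Lambda>\<^sub>U\<close> on balls in \<open>U\<close>; integrating
  from \<open>s\<close> to \<open>r\<close> costs at most a multiple of \<open>r\<close>. The boundary term needs an argument because the
  pairing \<open>gip\<close> is positive only on the Lie algebra: one checks that curvature and covariant
  derivative stay in it, the Lie algebra being closed under brackets and, as a closed subspace,
  under differentiation. The curvature bound implies the other one since \<open>q\<^sub>i\<^sup>+ \<le> |F|\<^sup>2\<close>.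
\<close>

section \<open>Differentiation of functions with values in a closed subspace\<close>

text \<open>The derivative along \<open>v\<close> is the limit of difference quotients that lie in
  \<open>S\<close> for all small \<open>t\<close>, and closedness of \<open>S\<close> passes
  membership to the limit.\<close>

lemma frechet_derivative_in_closed_subspace:
  assumes f: "f differentiable (at x)" and S: "closed S" "subspace S"
    and ev: "\<forall>\<^sub>F y in nhds x. f y \<in> S"
  shows "frechet_derivative f (at x) v \<in> S"
proof -
  let ?D = "frechet_derivative f (at x)" and ?Q = "\<lambda>t::real. (f (x + t *\<^sub>R v) - f x) /\<^sub>R t"
  \<comment> \<open>The base point is written as the value at 0 of the line
    \<open>x + t *\<^sub>R v\<close>, the shape that the chain rule expects.\<close>
  have D: "(f has_derivative ?D) (at (x + 0 *\<^sub>R v))"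
    using frechet_derivative_works[THEN iffD1, OF f] by simp
  have "((\<lambda>t::real. x + t *\<^sub>R v) has_derivative (\<lambda>t. t *\<^sub>R v)) (at 0)"
    by (auto intro!: derivative_eq_intros)
  then have "((\<lambda>t::real. f (x + t *\<^sub>R v)) has_derivative (\<lambda>t. ?D (t *\<^sub>R v))) (at 0)"
    using D by (rule has_derivative_compose)
  then have "((\<lambda>t. norm (f (x + t *\<^sub>R v) - f x - ?D (t *\<^sub>R v)) / norm t) \<longlongrightarrow> 0) (at 0)"
    by (simp add: has_derivative_at)
  moreover have "norm (f (x + t *\<^sub>R v) - f x - ?D (t *\<^sub>R v)) / norm t = norm (?Q t - ?D v)"
    if "t \<noteq> 0" for t
  proof -
    have "?Q t - ?D v = (f (x + t *\<^sub>R v) - f x - ?D (t *\<^sub>R v)) /\<^sub>R t"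
      using that linear_scale[OF has_derivative_linear[OF D]] by (simp add: scaleR_diff_right)
    then show ?thesis
      by (simp only: norm_scaleR) (simp add: divide_inverse mult.commute)
  qed
  then have "\<forall>\<^sub>F t in at 0. norm (f (x + t *\<^sub>R v) - f x - ?D (t *\<^sub>R v)) / norm t = norm (?Q t - ?D v)"
    by (simp add: eventually_at_filter)
  ultimately have "((\<lambda>t. norm (?Q t - ?D v)) \<longlongrightarrow> 0) (at 0)"
    by (rule Lim_transform_eventually)
  then have lim: "(?Q \<longlongrightarrow> ?D v) (at 0)"
    by (rule LIM_zero_cancel[OF tendsto_norm_zero_cancel])
  have "((\<lambda>t::real. x + t *\<^sub>R v) \<longlongrightarrow> x) (at 0)"
    by (auto intro!: tendsto_eq_intros)
  with ev have "\<forall>\<^sub>F t in at 0. f (x + t *\<^sub>R v) \<in> S"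
    by (rule eventually_compose_filterlim)
  \<comment> \<open>The filter \<open>nhds x\<close> includes \<open>x\<close> itself, so
    \<open>ev\<close> also gives \<open>f x \<in> S\<close>.\<close>
  moreover have "?Q t \<in> S" if "f (x + t *\<^sub>R v) \<in> S" for t
    using that eventually_nhds_x_imp_x[OF ev] by (intro subspace_scale subspace_diff S(2))
  ultimately have "\<forall>\<^sub>F t in at 0. ?Q t \<in> S"
    by (rule eventually_mono)
  with lim show ?thesis
    by (intro Lim_in_closed_set[OF S(1) _ _ lim]) simp_all
qed

section \<open>The Lie algebras and their invariant pairings\<close>

lemma ctranspose_mult: "ctranspose (a ** b) = ctranspose b ** ctranspose a"
  by (simp add: ctranspose_def matrix_matrix_mult_def vec_eq_iff mult.commute)

text \<open>Linearity is over the reals: multiplication by \<open>\<i>\<close> turns skew-Hermitian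
  matrices into Hermitian ones.\<close>

lemma subspace_gauge_algebra: "subspace (gauge_algebra G :: ('m::finite) cmat set)"
proof -
  have "ctranspose (a + b) = ctranspose a + ctranspose b"
    "ctranspose (r *\<^sub>R a) = r *\<^sub>R ctranspose a" "ctranspose (0 :: 'm cmat) = 0"
    "transpose (a + b) = transpose a + transpose b"
    "transpose (r *\<^sub>R a) = r *\<^sub>R transpose a" "transpose (0 :: 'm cmat) = 0"
    "trace (r *\<^sub>R a) = r *\<^sub>R trace a" "trace (0 :: 'm cmat) = 0"
    for a b :: "'m cmat" and r :: real
    by (simp_all add: ctranspose_def transpose_def trace_def vec_eq_iff scaleR_sum_right)
  then show ?thesis
    by (cases G) (auto simp: subspace_def trace_add scaleR_conv_of_real[where 'a = complex])
qed

lemma closed_gauge_algebra: "closed (gauge_algebra G :: ('m::finite) cmat set)"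
  by (rule closed_subspace[OF subspace_gauge_algebra])

lemma minus_matrix_mult: "(- a) ** (- b) = a ** (b :: complex ^ 'n ^ 'm)"
  by (simp add: matrix_matrix_mult_def vec_eq_iff)

text \<open>Transposition reverses products and the two minus signs cancel, so
  \<open>a ** b - b ** a\<close> goes to \<open>b ** a - a ** b\<close>; the trace of a commutator
  vanishes.\<close>

lemma lie_bracket_in_gauge_algebra:
  fixes a b :: "('m::finite) cmat"
  assumes "a \<in> gauge_algebra G" "b \<in> gauge_algebra G"
  shows "lie_bracket a b \<in> gauge_algebra G"
proof (cases G)
  case gauge_SU2
  then have "ctranspose a = - a" "ctranspose b = - b"
    using assms by auto
  moreover have "ctranspose (a ** b - b ** a) = ctranspose (a ** b) - ctranspose (b ** a)"
    by (simp add: ctranspose_def vec_eq_iff)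
  moreover have "trace (a ** b - b ** a) = 0"
    by (simp add: trace_sub trace_mul_sym[of b a])
  ultimately show ?thesis
    by (simp add: gauge_SU2 lie_bracket_def ctranspose_mult minus_matrix_mult)
next
  case gauge_SO3
  then have "transpose a = - a" "transpose b = - b"
    and real: "a $ i $ j \<in> \<real>" "b $ i $ j \<in> \<real>" for i j
    using assms by auto
  moreover have "transpose (a ** b - b ** a) = transpose (a ** b) - transpose (b ** a)"
    by (simp add: transpose_def vec_eq_iff)
  moreover have "(a ** b - b ** a) $ i $ j \<in> \<real>" for i j
    unfolding matrix_matrix_mult_def using real
    by (auto intro!: Reals_diff Reals_mult sum_in_Reals)
  ultimately show ?thesis
    by (simp add: gauge_SO3 lie_bracket_def matrix_transpose_mul minus_matrix_mult)
qed

text \<open>Real skew matrices are skew-Hermitian too, so in both cases the trace of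
  \<open>a ** a\<close> is minus the sum of the squared moduli of the entries, and both pairings
  carry a negative factor.\<close>

lemma gip_self_nonneg:
  fixes a :: "('m::finite) cmat"
  assumes "a \<in> gauge_algebra G"
  shows "gip G a a \<ge> 0"
proof -
  have cnj: "cnj (a $ j $ i) = - (a $ i $ j)" for i j
  proof (cases G)
    case gauge_SU2
    then have "ctranspose a $ i $ j = (- a) $ i $ j"
      using assms by simp
    then show ?thesis by (simp add: ctranspose_def)
  next
    case gauge_SO3
    then have "transpose a $ i $ j = (- a) $ i $ j" "a $ j $ i \<in> \<real>"
      using assms by auto
    then show ?thesis by (simp add: transpose_def Reals_cnj_iff)
  qed
  have "a $ i $ j * a $ j $ i = - (a $ i $ j * cnj (a $ i $ j))" for i j
    unfolding cnj[of j i, symmetric] cnj[of i j] by simp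
  then have "Re (trace (a ** a)) = - (\<Sum>i\<in>UNIV. \<Sum>j\<in>UNIV. (cmod (a $ i $ j))\<^sup>2)"
    by (simp add: trace_def matrix_matrix_mult_def sum_negf flip: complex_norm_square)
  moreover have "(\<Sum>i\<in>UNIV. \<Sum>j\<in>UNIV. (cmod (a $ i $ j))\<^sup>2) \<ge> 0"
    by (intro sum_nonneg) auto
  ultimately show ?thesis
    by (cases G) auto
qed

section \<open>Adjoint-valued fields and nonnegativity of their densities\<close>

lemma chart_at_in_atlas:
  assumes "x \<in> carr M"
  shows "chart_at M x \<in> atlas M" "x \<in> fst (chart_at M x)"
proof -
  have "\<exists>\<kappa>. \<kappa> \<in> atlas M \<and> x \<in> fst \<kappa>"
    using assms unfolding carr_def by blast
  from someI_ex[OF this] show "chart_at M x \<in> atlas M" "x \<in> fst (chart_at M x)"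
    unfolding chart_at_def by blast+
qed

lemma gauge_at_in_gauges:
  assumes "principal_bundle G M P" "x \<in> carr M"
  shows "gauge_at P x \<in> gauges P" "x \<in> gdom P (gauge_at P x)"
proof -
  have "\<exists>\<alpha>. \<alpha> \<in> gauges P \<and> x \<in> gdom P \<alpha>"
    using assms unfolding principal_bundle_def by blast
  from someI_ex[OF this] show "gauge_at P x \<in> gauges P" "x \<in> gdom P (gauge_at P x)"
    unfolding gauge_at_def by blast+
qed

text \<open>\<open>ad_norm2\<close> evaluates \<open>T\<close> only in the selected gauge and chart,
  so membership is asked for just there.\<close>

lemma ad_norm2_nonneg:
  assumes "\<And>vs. length vs = k \<Longrightarrow> T (gauge_at P x) (chart_at M x) x vs \<in> gauge_algebra G"
  shows "ad_norm2 G M P k T x \<ge> 0"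
  using assms unfolding ad_norm2_def Let_def form_norm2_def tensor_norm2_def
  by (auto intro!: sum_nonneg divide_nonneg_nonneg gip_self_nonneg)

text \<open>\<open>smooth_map\<close> includes openness of the coordinate domain, so the coordinate
  expression of \<open>u\<close> is algebra-valued in a whole neighbourhood and the closed-subspace
  lemma applies.\<close>

lemma pd_in_gauge_algebra:
  fixes u :: "'x::topological_space \<Rightarrow> ('m::finite) cmat"
  assumes "smooth_atlas (atlas M)" "\<kappa> \<in> atlas M" "x \<in> fst \<kappa> \<inter> D"
    and sm: "smooth_map (snd \<kappa> ` (fst \<kappa> \<inter> D)) (\<lambda>p. u (cinv \<kappa> p))"
    and u: "\<And>y. y \<in> fst \<kappa> \<inter> D \<Longrightarrow> u y \<in> gauge_algebra G"
  shows "pd \<kappa> u x v \<in> gauge_algebra G"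
  unfolding pd_def
proof (rule frechet_derivative_in_closed_subspace[OF _ closed_gauge_algebra subspace_gauge_algebra])
  have inv: "cinv \<kappa> (snd \<kappa> y) = y" if "y \<in> fst \<kappa>" for y
    using assms(1,2) that by (auto simp: smooth_atlas_def homeomorphism_def)
  have x: "snd \<kappa> x \<in> snd \<kappa> ` (fst \<kappa> \<inter> D)"
    using assms(3) by blast
  \<comment> \<open>For the empty list of directions \<open>iter_deriv\<close> is the function
    itself.\<close>
  have "iter_deriv (\<lambda>p. u (cinv \<kappa> p)) [] differentiable (at (snd \<kappa> x))"
    using sm x unfolding smooth_map_def by blast
  then show "(\<lambda>p. u (cinv \<kappa> p)) differentiable (at (snd \<kappa> x))"
    by simp
  have "open (snd \<kappa> ` (fst \<kappa> \<inter> D))"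
    using sm by (simp add: smooth_map_def)
  then have "\<forall>\<^sub>F p in nhds (snd \<kappa> x). p \<in> snd \<kappa> ` (fst \<kappa> \<inter> D)"
    using x by (rule eventually_nhds_in_open)
  then show "\<forall>\<^sub>F p in nhds (snd \<kappa> x). u (cinv \<kappa> p) \<in> gauge_algebra G"
    by (rule eventually_mono) (auto simp: inv u)
qed

lemma connection_in_gauge_algebra:
  assumes "connection_on G M P A" "\<alpha> \<in> gauges P" "\<kappa> \<in> atlas M" "x \<in> fst \<kappa> \<inter> gdom P \<alpha>"
  shows "A \<alpha> \<kappa> x [v] \<in> gauge_algebra G"
  using assms unfolding connection_on_def by blast

lemma pd_connection_in_gauge_algebra:
  assumes "smooth_atlas (atlas M)" and conn: "connection_on G M P A"
    and \<alpha>: "\<alpha> \<in> gauges P" and \<kappa>: "\<kappa> \<in> atlas M" "x \<in> fst \<kappa> \<inter> gdom P \<alpha>"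
  shows "pd \<kappa> (\<lambda>y. A \<alpha> \<kappa> y [w]) x v \<in> gauge_algebra G"
proof (rule pd_in_gauge_algebra[OF assms(1) \<kappa>])
  have "tensor_on M (gdom P \<alpha>) 1 (A \<alpha>)"
    using conn \<alpha> unfolding connection_on_def by blast
  moreover have "length [w] = 1" by simp
  ultimately show "smooth_map (snd \<kappa> ` (fst \<kappa> \<inter> gdom P \<alpha>)) (\<lambda>p. A \<alpha> \<kappa> (cinv \<kappa> p) [w])"
    using \<kappa>(1) unfolding tensor_on_def by blast
qed (rule connection_in_gauge_algebra[OF conn \<alpha> \<kappa>(1)])

lemma curvature_in_gauge_algebra:
  assumes "smooth_atlas (atlas M)" "connection_on G M P A"
    "\<alpha> \<in> gauges P" "\<kappa> \<in> atlas M" "x \<in> fst \<kappa> \<inter> gdom P \<alpha>"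
  shows "curvature A \<alpha> \<kappa> x vs \<in> gauge_algebra G"
  unfolding curvature_def
  by (intro subspace_add subspace_diff subspace_gauge_algebra lie_bracket_in_gauge_algebra
      pd_connection_in_gauge_algebra[OF assms] connection_in_gauge_algebra[OF assms(2-)])

lemma cov_higgs_in_gauge_algebra:
  assumes "smooth_atlas (atlas M)" "connection_on G M P A" and higgs: "higgs_on G M P \<Phi>"
    and \<alpha>: "\<alpha> \<in> gauges P" and \<kappa>: "\<kappa> \<in> atlas M" "x \<in> fst \<kappa> \<inter> gdom P \<alpha>"
  shows "cov_higgs A \<Phi> \<alpha> \<kappa> x vs \<in> gauge_algebra G"
proof -
  have \<Phi>: "\<Phi> \<alpha> y \<in> gauge_algebra G" if "y \<in> gdom P \<alpha>" for y
    using higgs \<alpha> that unfolding higgs_on_def by blast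
  have "smooth_fun M (gdom P \<alpha>) (\<Phi> \<alpha>)"
    using higgs \<alpha> unfolding higgs_on_def by blast
  then have "smooth_map (snd \<kappa> ` (fst \<kappa> \<inter> gdom P \<alpha>)) (\<lambda>p. \<Phi> \<alpha> (cinv \<kappa> p))"
    using \<kappa>(1) unfolding smooth_fun_def o_def by blast
  then have "pd \<kappa> (\<Phi> \<alpha>) x v \<in> gauge_algebra G" for v
    using \<Phi> by (intro pd_in_gauge_algebra[OF assms(1) \<kappa>]) auto
  then show ?thesis
    unfolding cov_higgs_def using \<Phi> \<kappa>(2)
    by (intro subspace_add subspace_gauge_algebra lie_bracket_in_gauge_algebra
        connection_in_gauge_algebra[OF assms(2) \<alpha> \<kappa>]) auto
qed

text \<open>This gives the pointwise bound of \<open>q_density\<close> by \<open>curv2\<close>,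
  which reduces the curvature hypothesis to the one on the positive part.\<close>

lemma covh2_nonneg:
  assumes "smooth_atlas (atlas M)" "principal_bundle G M P"
    "connection_on G M P A" "higgs_on G M P \<Phi>" "x \<in> carr M"
  shows "covh2 G M P A \<Phi> x \<ge> 0"
  unfolding covh2_def using assms
  by (intro ad_norm2_nonneg cov_higgs_in_gauge_algebra)
    (auto simp: chart_at_in_atlas gauge_at_in_gauges)

text \<open>Curvature and covariant derivative are algebra-valued on every argument list, so the
  contractions are too, whatever vector \<open>radial_normal\<close> denotes.\<close>

lemma radial_density_nonneg:
  assumes "smooth_atlas (atlas M)" "principal_bundle G M P"
    "connection_on G M P A" "higgs_on G M P \<Phi>" "y \<in> carr M"
  shows "radial_density G M P A \<Phi> x y \<ge> 0"
  unfolding radial_density_def using assms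
  by (intro add_nonneg_nonneg ad_norm2_nonneg cov_higgs_in_gauge_algebra curvature_in_gauge_algebra)
    (auto simp: chart_at_in_atlas gauge_at_in_gauges)

section \<open>Two facts from real analysis\<close>

text \<open>No measurability is assumed: the Bochner integral of a non-integrable function is 0.\<close>

lemma set_lebesgue_integral_le_nn_integral_pos_part:
  fixes f :: "'a \<Rightarrow> real"
  assumes "ennreal C * (\<integral>\<^sup>+x\<in>S. ennreal (max 0 (f x)) \<partial>M) \<le> ennreal K" "C > 0" "K \<ge> 0"
  shows "C * (LINT x:S|M. f x) \<le> K"
proof (cases "set_integrable M S f")
  case True
  then have int: "integrable M (\<lambda>x. indicator S x * f x)"
    by (simp add: set_integrable_def)
  then have intp: "integrable M (\<lambda>x. max 0 (indicator S x * f x))"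
    by (intro integrable_max) auto
  have "(\<integral>\<^sup>+x\<in>S. ennreal (max 0 (f x)) \<partial>M) = (\<integral>\<^sup>+x. ennreal (max 0 (indicator S x * f x)) \<partial>M)"
    by (intro nn_integral_cong) (auto split: split_indicator)
  also have "\<dots> = ennreal (\<integral>x. max 0 (indicator S x * f x) \<partial>M)"
    by (intro nn_integral_eq_integral intp) auto
  finally have "ennreal (C * (\<integral>x. max 0 (indicator S x * f x) \<partial>M)) \<le> ennreal K"
    using assms by (simp add: ennreal_mult')
  then have "C * (\<integral>x. max 0 (indicator S x * f x) \<partial>M) \<le> K"
    using \<open>K \<ge> 0\<close> by (simp add: ennreal_le_iff)
  moreover have "(LINT x:S|M. f x) \<le> (\<integral>x. max 0 (indicator S x * f x) \<partial>M)"
    unfolding set_lebesgue_integral_def real_scaleR_def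
    by (intro integral_mono int intp) auto
  ultimately show ?thesis
    using \<open>C > 0\<close> by (meson mult_left_mono less_imp_le order_trans)
next
  case False
  then have "(LINT x:S|M. f x) = 0"
    by (simp add: set_integrable_def set_lebesgue_integral_def not_integrable_integral_eq)
  with assms show ?thesis by simp
qed

text \<open>The mean value theorem stands in for integration of the derivative, so a pointwise lower
  bound suffices.\<close>

lemma almost_monotone_of_deriv_ge:
  fixes f :: "real \<Rightarrow> real"
  assumes "s < r"
    and deriv: "\<And>t. s \<le> t \<Longrightarrow> t \<le> r \<Longrightarrow> \<exists>D \<ge> - K. (f has_real_derivative D) (at t within {s..r})"
  shows "f s \<le> f r + K * (r - s)"
proof -
  obtain D where D: "\<And>t. s \<le> t \<Longrightarrow> t \<le> r \<Longrightarrow> D t \<ge> - K"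
      "\<And>t. s \<le> t \<Longrightarrow> t \<le> r \<Longrightarrow> (f has_real_derivative D t) (at t within {s..r})"
    using deriv by metis
  have "\<exists>t\<in>{s<..<r}. f r - f s = D t * (r - s)"
    using \<open>s < r\<close> D(2) by (intro mvt_simple) (auto simp: has_field_derivative_def)
  then obtain t where t: "s < t" "t < r" "f r - f s = D t * (r - s)"
    by auto
  have "D t * (r - s) \<ge> - K * (r - s)"
    using D(1)[of t] t by (intro mult_right_mono) auto
  with t show ?thesis by simp
qed

section \<open>Monotonicity from the Morrey bounds\<close>

lemma effective_monotonicity_of_morrey_bound:
  fixes X :: "('x::topological_space, 'e::euclidean_space) riem"
  assumes X: "smooth_atlas (atlas X)" "carr X = UNIV" and P: "principal_bundle G X P"
    and pair: "\<And>i. connection_on G X P (A i)" "\<And>i. higgs_on G X P (\<Phi> i)"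
    and m: "\<And>i. m i > 0" and "c \<ge> 0"
    and stress: "\<And>i. stress_energy_inequality G X P (A i) (\<Phi> i) (m i) c r\<^sub>0"
    and morrey: "morrey_bound X m r\<^sub>0 U (\<lambda>i x. max 0 (q_density G X P (A i) (\<Phi> i) x))"
  shows "effective_monotonicity G X P A \<Phi> m c r\<^sub>0 U 1"
proof -
  obtain \<Lambda> :: real and iU where
    "\<forall>i\<ge>iU. \<forall>y\<in>carr X. \<forall>s. gball X y s \<subseteq> U \<and> 0 < s \<and> s \<le> r\<^sub>0 \<longrightarrow>
      ennreal (inverse (m i) * s powi (2 - int DIM('e))) *
        (\<integral>\<^sup>+z\<in>gball X y s. ennreal (max 0 (q_density G X P (A i) (\<Phi> i) z)) \<partial>riem_measure X)
          \<le> ennreal \<Lambda>"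
    using morrey unfolding morrey_bound_def by blast
  then have \<Lambda>: "ennreal (inverse (m i) * s powi (2 - int DIM('e))) *
      (\<integral>\<^sup>+z\<in>gball X y s. ennreal (max 0 (q_density G X P (A i) (\<Phi> i) z)) \<partial>riem_measure X)
        \<le> ennreal \<Lambda>"
    if "i \<ge> iU" "gball X y s \<subseteq> U" "0 < s" "s \<le> r\<^sub>0" for i y s
    using that X(2) by simp
  \<comment> \<open>\<open>ennreal\<close> sends a negative \<open>\<Lambda>\<close> to 0, so the
    real bound extracted from the hypothesis is \<open>max 0 \<Lambda>\<close>; the exponential
    bounds the weight \<open>exp (c * t\<^sup>2)\<close> for all \<open>t\<close> up to
    \<open>r\<^sub>0\<close>.\<close>
  define K where "K = exp (c * r\<^sub>0\<^sup>2) * max 0 \<Lambda>"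
  have "K \<ge> 0" by (simp add: K_def)
  \<comment> \<open>\<open>K\<close> may be 0 while the constant sought must be positive, hence
    \<open>K + 1\<close>.\<close>
  have "exp (c * s\<^sup>2) * theta G X P (A i) (\<Phi> i) (m i) x s
      \<le> exp (c * r\<^sup>2) * theta G X P (A i) (\<Phi> i) (m i) x r + (K + 1) * r powr 1"
    if i: "i \<ge> iU" and U: "gball X x r \<subseteq> U" and sr: "0 < s" "s < r" "r \<le> r\<^sub>0" for i x r s
  proof -
    let ?f = "\<lambda>t. exp (c * t\<^sup>2) * theta G X P (A i) (\<Phi> i) (m i) x t"
    have "\<exists>D \<ge> - K. (?f has_real_derivative D) (at t within {s..r})" if t: "s \<le> t" "t \<le> r" for t
    proof -
      have "0 < t" "t \<le> r\<^sub>0" using t sr by auto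
      define rad where "rad = (LINT y:frontier (gball X x t)|hausdorff_measure X (DIM('e) - 1).
        radial_density G X P (A i) (\<Phi> i) x y)"
      define q where "q = (LINT y:gball X x t|riem_measure X. q_density G X P (A i) (\<Phi> i) y)"
      obtain D where D: "(?f has_real_derivative D) (at t within {0<..r\<^sub>0})"
        "D \<ge> 2 * inverse (m i) * exp (c * t\<^sup>2) * t powi (3 - int DIM('e)) * rad
          - exp (c * t\<^sup>2) * t powi (2 - int DIM('e)) * inverse (m i) * q"
        using stress[of i] X(2) \<open>0 < t\<close> \<open>t \<le> r\<^sub>0\<close>
        unfolding stress_energy_inequality_def rad_def q_def by blast
      \<comment> \<open>A pointwise sign is enough: a non-integrable integrand has integral
        0.\<close>
      have "rad \<ge> 0"
        unfolding rad_def set_lebesgue_integral_def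
        by (intro Bochner_Integration.integral_nonneg)
          (auto simp: radial_density_nonneg[OF X(1) P pair] X(2))
      then have "2 * inverse (m i) * exp (c * t\<^sup>2) * t powi (3 - int DIM('e)) * rad \<ge> 0"
        using \<open>0 < t\<close> m[of i] by (intro mult_nonneg_nonneg) auto
      moreover have "exp (c * t\<^sup>2) * t powi (2 - int DIM('e)) * inverse (m i) * q \<le> K"
      proof -
        \<comment> \<open>Only the ball of radius \<open>r\<close> is assumed to lie in
          \<open>U\<close>; the concentric balls with \<open>t \<le> r\<close> inherit this, so the
          Morrey bound holds at every intermediate radius.\<close>
        have "gball X x t \<subseteq> U"
          using U t unfolding gball_def by auto
        then have "inverse (m i) * t powi (2 - int DIM('e)) * q \<le> max 0 \<Lambda>"
          using \<Lambda>[OF i, of x t] \<open>0 < t\<close> \<open>t \<le> r\<^sub>0\<close> m[of i] unfolding q_def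
          by (intro set_lebesgue_integral_le_nn_integral_pos_part) (auto simp: max_def ennreal_neg)
        moreover have "exp (c * t\<^sup>2) \<le> exp (c * r\<^sub>0\<^sup>2)"
          using \<open>0 < t\<close> \<open>t \<le> r\<^sub>0\<close> \<open>c \<ge> 0\<close> by (auto intro!: mult_left_mono power_mono)
        ultimately have "exp (c * t\<^sup>2) * (inverse (m i) * t powi (2 - int DIM('e)) * q)
            \<le> exp (c * t\<^sup>2) * max 0 \<Lambda>" "exp (c * t\<^sup>2) * max 0 \<Lambda> \<le> K"
          unfolding K_def by (auto intro!: mult_left_mono mult_right_mono)
        then have "exp (c * t\<^sup>2) * (inverse (m i) * t powi (2 - int DIM('e)) * q) \<le> K"
          by (rule order_trans)
        then show ?thesis by (simp add: mult_ac)
      qed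
      ultimately have "D \<ge> - K" using D(2) by linarith
      \<comment> \<open>The given derivative is within \<open>{0<..r\<^sub>0}\<close>, hence
        one-sided at \<open>r\<^sub>0\<close>; this set contains \<open>{s..r}\<close>.\<close>
      moreover have "(?f has_real_derivative D) (at t within {s..r})"
        using D(1) by (rule DERIV_subset) (use sr in auto)
      ultimately show ?thesis by blast
    qed
    then have "?f s \<le> ?f r + K * (r - s)"
      by (rule almost_monotone_of_deriv_ge[OF \<open>s < r\<close>])
    \<comment> \<open>Since \<open>s > 0\<close>, the length \<open>r - s\<close> is at most
      \<open>r\<close>; this is the source of the exponent 1.\<close>
    moreover have "K * (r - s) \<le> (K + 1) * r powr 1"
      using \<open>K \<ge> 0\<close> sr by (auto intro!: mult_mono)
    ultimately show ?thesis by linarith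
  qed
  moreover have "K + 1 > 0" using \<open>K \<ge> 0\<close> by simp
  ultimately show ?thesis
    unfolding effective_monotonicity_def by (intro conjI exI[of _ "K + 1"] exI[of _ iU]) auto
qed

text \<open>Comparing the \<open>ennreal\<close> images counts negative values as 0, and nonnegative
  integrals are monotone without measurability.\<close>

lemma morrey_bound_mono:
  assumes "morrey_bound X m r\<^sub>0 U f" "\<And>i x. ennreal (g i x) \<le> ennreal (f i x)"
  shows "morrey_bound X m r\<^sub>0 U g"
proof -
  have "a * (\<integral>\<^sup>+z\<in>B. ennreal (g i z) \<partial>M) \<le> a * (\<integral>\<^sup>+z\<in>B. ennreal (f i z) \<partial>M)" for a B i M
    by (intro mult_left_mono nn_integral_mono mult_right_mono assms(2)) auto
  with assms(1) show ?thesis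
    unfolding morrey_bound_def by (meson order_trans)
qed

theorem proposition3p27:
  fixes X :: "('x::{t2_space,second_countable_topology}, 'e::euclidean_space) riem"
    and S :: "('x, 'e) special_structure"
    and L :: "('y::{t2_space,second_countable_topology}, 's::euclidean_space) riem"
    and S\<^sub>C :: "(real \<times> 'y, real \<times> 's) special_structure"
    and \<Upsilon> :: "real \<times> 'y \<Rightarrow> 'x" and \<rho> :: "'x \<Rightarrow> real"
    and G :: gauge_kind
    and P :: "('a, 'x, 'm::finite) gbundle"
    and A :: "nat \<Rightarrow> ('a, 'x, 'e, 'm) connection" and \<Phi> :: "nat \<Rightarrow> ('a, 'x, 'm) higgs"
    and m :: "nat \<Rightarrow> real"
    and Q :: "nat \<Rightarrow> ('b, 'y, 'm) gbundle"
    and Ainf :: "nat \<Rightarrow> ('b, 'y, 's, 'm) connection" and \<Phi>inf :: "nat \<Rightarrow> ('b, 'y, 'm) higgs"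
    and \<beta> \<Theta>inf :: "('y, 's, real) tfield"
    and c r\<^sub>0 :: real and U :: "'x set"
  assumes geometry: "ac_special_holonomy X S L S\<^sub>C \<Upsilon>" "radius_function X \<Upsilon> \<rho>"
    and Theta_infinity: "represents_Theta_infinity X S L \<Upsilon> \<Theta>inf"
    and pbundle: "CARD('m) = matrix_size G" "principal_bundle G X P"
    and monopoles: "\<And>i. Theta_monopole G X S P (A i) (\<Phi> i)"
      "\<And>i. irreducible_pair X P (A i) (\<Phi> i)"
      "\<And>i. intermediate_energy G X S P (A i) (\<Phi> i) < \<infinity>"
      "\<And>i. quadratic_curvature_decay G X \<rho> P (A i)"
    and mass: "\<And>i. has_mass G \<rho> P (\<Phi> i) (m i)"
    and limit: "\<And>i. limit_at_infinity G X L \<Upsilon> P (A i) (\<Phi> i) (m i) (Q i) (Ainf i) (\<Phi>inf i)"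
    and large_mass: "filterlim m at_top sequentially"
    and monopole_class: "\<And>i. represents_monopole_class G L (Q i) (Ainf i) (\<Phi>inf i) (m i) \<beta>"
      "cup_pairing L 2 (DIM('e) - 3) \<beta> \<Theta>inf \<noteq> 0"
    and constants: "c \<ge> 0" "r\<^sub>0 > 0"
      "\<And>i. stress_energy_inequality G X P (A i) (\<Phi> i) (m i) c r\<^sub>0"
    and "open U"
  shows "(morrey_bound X m r\<^sub>0 U (\<lambda>i x. max 0 (q_density G X P (A i) (\<Phi> i) x))
            \<longrightarrow> effective_monotonicity G X P A \<Phi> m c r\<^sub>0 U 1) \<and>
         (morrey_bound X m r\<^sub>0 U (\<lambda>i. curv2 G X P (A i))
            \<longrightarrow> effective_monotonicity G X P A \<Phi> m c r\<^sub>0 U 1)"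
proof -
  have X: "smooth_atlas (atlas X)" "carr X = UNIV"
    using geometry(1) by (auto simp: ac_special_holonomy_def oriented_riem_def)
  have pair: "connection_on G X P (A i)" "higgs_on G X P (\<Phi> i)" for i
    using monopoles(1)[of i] by (auto simp: Theta_monopole_def)
  have m: "m i > 0" for i
    using mass[of i] by (simp add: has_mass_def)
  note main = effective_monotonicity_of_morrey_bound[where A = A and \<Phi> = \<Phi> and m = m,
      OF X pbundle(2) pair m constants(1,3)]
  have "q_density G X P (A i) (\<Phi> i) x \<le> curv2 G X P (A i) x" for i x
    using covh2_nonneg[OF X(1) pbundle(2) pair, of x i] X(2) by (simp add: q_density_def)
  \<comment> \<open>Where \<open>q_density\<close> is negative the left side is 0; elsewhere the
    previous inequality applies.\<close>
  then have "ennreal (max 0 (q_density G X P (A i) (\<Phi> i) x)) \<le> ennreal (curv2 G X P (A i) x)" for i x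
    by (auto simp: max_def intro: ennreal_leI)
  then have "morrey_bound X m r\<^sub>0 U (\<lambda>i x. max 0 (q_density G X P (A i) (\<Phi> i) x))"
    if "morrey_bound X m r\<^sub>0 U (\<lambda>i. curv2 G X P (A i))"
    using that by (rule morrey_bound_mono[rotated])
  with main show ?thesis by blast
qed

end
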